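(* There exist constants $c>0$ and $n_0$ such that for every $n\ge n_0$ there are a dynamic graph $\mathcal H\in\mathcal G_{conn}$ on $n$ nodes and nodes $u,v$ such that $$H_k(u,v)\ \ge\ c\,\frac{n^{5/2}}{\sqrt k\,\ln n}\qquad\text{for all integers } 1\le k\le n/16,$$ where smoothing is with respect to $\mathcal G_{conn}$.
   Context: Graphs are undirected on a node set $V$ with $n=|V|$. A dynamic graph is an infinite sequence $\mathcal H=G_1,G_2,\dots$ of graphs on $V$. $\mathcal G_{conn}$ is the set of dynamic graphs in which every individual graph is connected. Smoothing: the edit distance between two graphs on $V$ is the minimum number of edge additions and removals (over the $\binom n2$ pairs of distinct nodes) transforming one into the other. To $k$-smooth $\mathcal H\in\mathcal G_{conn}$ with respect to $\mathcal G_{conn}$ is to replace each $G_t$, independently over $t$, by a graph sampled uniformly at random from all connected graphs on $V$ at edit distance at most $k$ from $G_t$. Random walk: a random walk on a dynamic graph starts at $u$; if at the beginning of time step $t$ it is at $v_t$, then in step $t$ it moves to a neighbor of $v_t$ in the graph at time $t$ chosen uniformly at random (possibly $v_t$ itself if it has a self-loop; self-loops are unaffected by smoothing). The hitting time $H_k(u,v)$ is the expected number of steps taken by a random walk starting at $u$ until first reaching $v$ in the random $k$-smoothed version of $\mathcal H$, the expectation being over both the walk and the smoothing. *)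

theory Defs
  imports "HOL-Probability.Probability" "HOL-Library.Extended_Nat"
begin

section \<open>Graphs and dynamic graphs\<close>

text \<open>An undirected graph on a node set \<open>V\<close> is given by its edge set; the edge between \<open>x\<close> and
  \<open>y\<close> is the set \<open>{x, y}\<close>, and \<open>{x} = {x, x}\<close> is a self-loop at \<open>x\<close>.\<close>

type_synonym 'a graph = "'a set set"

definition graph_on :: "'a set \<Rightarrow> 'a graph \<Rightarrow> bool" where
  "graph_on V E \<longleftrightarrow> E \<subseteq> {{x, y} | x y. x \<in> V \<and> y \<in> V}"

definition connected_on :: "'a set \<Rightarrow> 'a graph \<Rightarrow> bool" where
  "connected_on V E \<longleftrightarrow> (\<forall>x\<in>V. \<forall>y\<in>V. (x, y) \<in> {(a, b). {a, b} \<in> E}\<^sup>*)"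

definition neighbors :: "'a graph \<Rightarrow> 'a \<Rightarrow> 'a set" where
  "neighbors E x = {y. {x, y} \<in> E}"

text \<open>A dynamic graph is a sequence indexed from \<open>0\<close>: \<open>H t\<close> is the graph used in the
  \<open>(t + 1)\<close>-st step.\<close>

type_synonym 'a dynamic_graph = "nat \<Rightarrow> 'a graph"

definition G_conn :: "'a set \<Rightarrow> 'a dynamic_graph set" where
  "G_conn V = {H. \<forall>t. graph_on V (H t) \<and> connected_on V (H t)}"


section \<open>Smoothing\<close>

text \<open>One edit adds or removes an edge between two distinct nodes; self-loops cannot be edited.
  Graphs with different self-loops therefore have edit distance \<open>\<infinity>\<close>, the infimum of the
  empty set.\<close>

definition edit_step :: "'a set \<Rightarrow> 'a graph rel" where
  "edit_step V = {(E, E'). \<exists>x\<in>V. \<exists>y\<in>V. x \<noteq> y \<and>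
     ({x, y} \<notin> E \<and> E' = insert {x, y} E \<or> {x, y} \<in> E \<and> E' = E - {{x, y}})}"

definition edit_dist :: "'a set \<Rightarrow> 'a graph \<Rightarrow> 'a graph \<Rightarrow> enat" where
  "edit_dist V E E' = (INF m\<in>{m. (E, E') \<in> edit_step V ^^ m}. enat m)"

definition smoothing_ball :: "'a set \<Rightarrow> nat \<Rightarrow> 'a graph \<Rightarrow> 'a graph set" where
  "smoothing_ball V k E = {E'. graph_on V E' \<and> connected_on V E' \<and> edit_dist V E E' \<le> enat k}"

text \<open>The law of the \<open>k\<close>-smoothed version of \<open>H\<close>; the product measure makes the graphs of
  different time steps independent.\<close>

definition smoothed :: "'a set \<Rightarrow> nat \<Rightarrow> 'a dynamic_graph \<Rightarrow> 'a dynamic_graph measure" where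
  "smoothed V k H = (\<Pi>\<^sub>M t\<in>UNIV. measure_pmf (pmf_of_set (smoothing_ball V k (H t))))"


section \<open>Random walks and hitting times\<close>

text \<open>The walk on a fixed dynamic graph \<open>G\<close> is the law, on infinite trajectories
  \<open>\<omega> :: nat \<Rightarrow> 'a\<close>, that the Ionescu-Tulcea theorem associates with these transition
  probabilities: \<open>walk_kernel G u i \<omega>\<close> is the conditional law of the position \<open>\<omega> i\<close> given the
  positions before time \<open>i\<close>.\<close>

fun walk_kernel :: "'a dynamic_graph \<Rightarrow> 'a \<Rightarrow> nat \<Rightarrow> (nat \<Rightarrow> 'a) \<Rightarrow> 'a measure" where
  "walk_kernel G u 0 \<omega> = measure_pmf (return_pmf u)"
| "walk_kernel G u (Suc t) \<omega> = measure_pmf (pmf_of_set (neighbors (G t) (\<omega> t)))"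

definition random_walk :: "'a dynamic_graph \<Rightarrow> 'a \<Rightarrow> (nat \<Rightarrow> 'a) measure" where
  "random_walk G u =
     projective_family.lim UNIV
       (Ionescu_Tulcea.CI (walk_kernel G u) (\<lambda>_. count_space UNIV)) (\<lambda>_. count_space UNIV)"

definition steps_until :: "'a \<Rightarrow> (nat \<Rightarrow> 'a) \<Rightarrow> enat" where
  "steps_until v \<omega> = (INF t\<in>{t. \<omega> t = v}. enat t)"

definition hitting_time_on :: "'a dynamic_graph \<Rightarrow> 'a \<Rightarrow> 'a \<Rightarrow> ennreal" where
  "hitting_time_on G u v = (\<integral>\<^sup>+ \<omega>. ennreal_of_enat (steps_until v \<omega>) \<partial>random_walk G u)"

definition hitting_time :: "'a set \<Rightarrow> 'a dynamic_graph \<Rightarrow> nat \<Rightarrow> 'a \<Rightarrow> 'a \<Rightarrow> ennreal" where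
  "hitting_time V H k u v = (\<integral>\<^sup>+ G. hitting_time_on G u v \<partial>smoothed V k H)"


section \<open>Well-definedness\<close>

lemma edit_dist_refl [simp]: "edit_dist V E E = 0"
proof -
  have "edit_dist V E E \<le> enat 0"
    unfolding edit_dist_def by (rule INF_lower) simp
  then show ?thesis by (simp add: zero_enat_def[symmetric])
qed

lemma edit_step_loops:
  assumes "(E, E') \<in> edit_step V"
  shows "{x} \<in> E \<longleftrightarrow> {x} \<in> E'"
proof -
  from assms obtain a b where "a \<noteq> b" and E': "E' = insert {a, b} E \<or> E' = E - {{a, b}}"
    unfolding edit_step_def by blast
  from \<open>a \<noteq> b\<close> have "{x} \<noteq> {a, b}" by blast
  with E' show ?thesis by blast
qed

lemma self_mem_smoothing_ball:
  assumes "H \<in> G_conn V"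
  shows "H t \<in> smoothing_ball V k (H t)"
  using assms by (simp add: G_conn_def smoothing_ball_def)

lemma finite_smoothing_ball:
  assumes "finite V"
  shows "finite (smoothing_ball V k E)"
proof (rule finite_subset)
  show "smoothing_ball V k E \<subseteq> Pow (Pow V)"
  proof
    fix E' assume "E' \<in> smoothing_ball V k E"
    then have "E' \<subseteq> {{x, y} | x y. x \<in> V \<and> y \<in> V}"
      by (simp add: smoothing_ball_def graph_on_def)
    also have "\<dots> \<subseteq> Pow V" by blast
    finally show "E' \<in> Pow (Pow V)" by blast
  qed
qed (use assms in simp)

lemma prob_space_smoothed: "prob_space (smoothed V k H)"
  unfolding smoothed_def by (intro prob_space_PiM measure_pmf.prob_space_axioms)

lemma neighbors_nonempty:
  assumes "connected_on V E" "x \<in> V" "y \<in> V" "x \<noteq> y"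
  shows "neighbors E x \<noteq> {}"
proof -
  have "(x, y) \<in> {(a, b). {a, b} \<in> E}\<^sup>*"
    using assms by (auto simp: connected_on_def)
  then show ?thesis
    using \<open>x \<noteq> y\<close> by (cases rule: converse_rtranclE) (auto simp: neighbors_def)
qed

lemma Ionescu_Tulcea_walk_kernel:
  fixes G :: "'a::countable dynamic_graph"
  shows "Ionescu_Tulcea (walk_kernel G u) (\<lambda>_. count_space UNIV)"
proof (rule Ionescu_Tulcea.intro)
  fix i
  show "walk_kernel G u i \<in>
    measurable (PiM {0..<i} (\<lambda>_. count_space UNIV)) (subprob_algebra (count_space UNIV))"
  proof (cases i)
    case 0
    have "walk_kernel G u 0 = (\<lambda>_. measure_pmf (return_pmf u))"
      by (rule ext) simp
    then show ?thesis
      using 0 by (simp add: measurable_const measure_pmf_in_subprob_algebra)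
  next
    case (Suc t)
    have comp: "(\<lambda>\<omega>. \<omega> t) \<in> measurable (PiM {0..<Suc t} (\<lambda>_. count_space (UNIV :: 'a set))) (count_space UNIV)"
      by (rule measurable_component_singleton) simp
    have "(\<lambda>x. measure_pmf (pmf_of_set (neighbors (G t) x))) \<in>
      measurable (count_space UNIV) (subprob_algebra (count_space UNIV))"
      by (simp add: measure_pmf_in_subprob_algebra)
    from measurable_compose[OF comp this] have
      "(\<lambda>\<omega>. measure_pmf (pmf_of_set (neighbors (G t) (\<omega> t)))) \<in>
        measurable (PiM {0..<Suc t} (\<lambda>_. count_space UNIV)) (subprob_algebra (count_space UNIV))" .
    moreover have "walk_kernel G u (Suc t) = (\<lambda>\<omega>. measure_pmf (pmf_of_set (neighbors (G t) (\<omega> t))))"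
      by (rule ext) simp
    ultimately show ?thesis
      using Suc by simp
  qed
next
  fix i x
  show "prob_space (walk_kernel G u i x)"
    by (cases i) (simp_all add: measure_pmf.prob_space_axioms)
qed

end

theory Submission
  imports Defs
begin

text \<open>
  Take the static lollipop: a path of about \<open>n / 2\<close> nodes ending in \<open>v\<close>, attached to a clique that
  contains \<open>u\<close>. Since the graphs of different steps are independent, the walk on the smoothed graph
  is a Markov chain, and each pair of nodes is toggled with probability of order \<open>k / n\<^sup>2\<close>. From a path
  node the walk jumps to the clique with probability of order \<open>k / n\<close> per step, so it hits \<open>v\<close> first
  only from within distance of order \<open>L = sqrt (n / k)\<close>. A clique node has degree of order \<open>n\<close>, so the
  walk jumps from the clique to a given path node with probability of order \<open>k / n\<^sup>3\<close> only. Hence \<open>v\<close>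
  is reached at rate of order \<open>L * k / n\<^sup>3\<close>, which even gives the bound without the logarithm. The
  estimate is made rigorous by a potential \<open>\<psi>\<close> with \<open>\<psi> v \<ge> 1\<close> and \<open>\<psi> u = 0\<close> whose expected increase per
  step is at most \<open>\<epsilon>\<close>; then the expected hitting time is at least \<open>1 / (2 * \<epsilon>)\<close>.
\<close>

section \<open>Hitting times of averaged chains\<close>

lemma ennreal_of_enat_ge_sum_indicator:
  fixes x :: enat
  shows "(\<Sum>t<T. if enat t < x then 1 else 0 :: ennreal) \<le> ennreal_of_enat x"
proof (cases x)
  case (enat n)
  have "(\<Sum>t<T. if enat t < x then 1 else 0 :: ennreal) = of_nat (card {t. t < T \<and> t < n})"
    by (simp add: enat sum.If_cases Int_def)
  also have "\<dots> \<le> of_nat n"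
    using card_mono[of "{..<n}" "{t. t < T \<and> t < n}"] by (intro of_nat_mono) auto
  finally show ?thesis by (simp add: enat)
qed simp

text \<open>The mass of the walks from \<open>u\<close> that are at \<open>y\<close> at time \<open>t\<close> and lie in \<open>W\<close> at all earlier times;
  \<open>y\<close> itself need not belong to \<open>W\<close>.\<close>

primrec alive :: "(nat \<Rightarrow> 'a \<Rightarrow> 'a \<Rightarrow> 'b::comm_semiring_1) \<Rightarrow> 'a set \<Rightarrow> 'a \<Rightarrow> nat \<Rightarrow> 'a \<Rightarrow> 'b" where
  "alive K W u 0 y = (if y = u then 1 else 0)"
| "alive K W u (Suc t) y = (\<Sum>z\<in>W. alive K W u t z * K t z y)"

lemma alive_cong:
  assumes "\<And>s z y. s < t \<Longrightarrow> K s z y = K' s z y"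
  shows "alive K W u t y = alive K' W u t y"
  using assms by (induction t arbitrary: y) (auto intro!: sum.cong)

lemma alive_nonneg:
  fixes K :: "nat \<Rightarrow> 'a \<Rightarrow> 'a \<Rightarrow> 'b::linordered_idom"
  assumes "\<And>s z y. K s z y \<ge> 0"
  shows "alive K W u t y \<ge> 0"
  using assms by (induction t arbitrary: y) (auto intro!: sum_nonneg)

lemma alive_ennreal:
  assumes "\<And>s z y. K s z y \<ge> 0"
  shows "alive (\<lambda>s z y. ennreal (K s z y)) W u t y = ennreal (alive K W u t y)"
  using assms
  by (induction t arbitrary: y)
     (auto simp: sum_ennreal ennreal_mult alive_nonneg intro!: sum.cong sum_ennreal[symmetric] mult_nonneg_nonneg
        simp flip: sum_ennreal)

section \<open>Walks on a fixed dynamic graph\<close>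

abbreviation step_prob :: "'a graph \<Rightarrow> 'a \<Rightarrow> 'a \<Rightarrow> real" where
  "step_prob E z y \<equiv> pmf (pmf_of_set (neighbors E z)) y"

text \<open>The event depends only on the coordinates up to \<open>t\<close>, so its measure can be
  computed in the finite-dimensional law \<open>C 0 (Suc t)\<close> of the Ionescu-Tulcea
  construction. Integrating out the last coordinate yields the recursion of
  \<open>alive\<close>.\<close>

lemma emeasure_random_walk:
  fixes G :: "'a::countable dynamic_graph"
  assumes W: "finite W"
  shows "emeasure (random_walk G u) {\<omega>. (\<forall>i<t. \<omega> i \<in> W) \<and> \<omega> t = y} =
    alive (\<lambda>s z y. ennreal (step_prob (G s) z y)) W u t y"
proof -
  interpret Ionescu_Tulcea "walk_kernel G u" "\<lambda>_. count_space UNIV"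
    by (rule Ionescu_Tulcea_walk_kernel)
  define M where "M = (\<lambda>_::nat. count_space (UNIV::'a set))"
  define ev where "ev t y = {\<omega>\<in>space (PiM {0..<Suc t} M). (\<forall>i<t. \<omega> i \<in> W) \<and> \<omega> t = y}" for t y
  have ev_sets [measurable]: "ev t y \<in> sets (PiM {0..<Suc t} M)" for t y
    unfolding ev_def M_def by measurable
  have und: "(\<lambda>_. undefined) \<in> space (PiM {0..<0} M)"
    by (simp add: space_PiM)
  have C: "emeasure (C 0 (Suc t) (\<lambda>_. undefined)) (ev t y) =
      alive (\<lambda>s z y. ennreal (step_prob (G s) z y)) W u t y" for t y
  proof (induction t arbitrary: y)
    case 0
    have "emeasure (C 0 (Suc 0) (\<lambda>_. undefined)) (ev 0 y) =
        emeasure (eP 0 (\<lambda>_. undefined)) (ev 0 y)"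
      using und bind_return[OF measurable_eP[of 0], of "\<lambda>_. undefined"] by (simp add: M_def)
    also have "\<dots> = emeasure (measure_pmf (return_pmf u)) {y}"
      using und ev_sets[of 0 y]
      by (subst emeasure_eP)
         (auto simp: M_def ev_def space_PiM PiE_iff extensional_def intro!: arg_cong2[where f=emeasure])
    also have "\<dots> = (if y = u then 1 else 0)"
      by (simp add: emeasure_pmf_single)
    finally show ?case by simp
  next
    case (Suc t)
    let ?C = "C 0 (Suc t) (\<lambda>_. undefined)"
    have spC: "space ?C = space (PiM {0..<Suc t} M)"
      using space_C[OF und[unfolded M_def], of "Suc t"] by (simp add: M_def)
    have stC: "sets ?C = sets (PiM {0..<Suc t} M)"
      using sets_C[OF und[unfolded M_def], of "Suc t"] by (simp add: M_def)
    have "emeasure (C 0 (Suc (Suc t)) (\<lambda>_. undefined)) (ev (Suc t) y) =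
       (\<integral>\<^sup>+\<omega>. emeasure (eP (Suc t) \<omega>) (ev (Suc t) y) \<partial>?C)"
      using measurable_eP[of "Suc t"] ev_sets[of "Suc t" y] spC stC
      by (subst C.simps(2), subst emeasure_bind[where N="PiM {0..<Suc (Suc t)} M"])
         (auto simp: M_def space_PiM_empty_iff cong: measurable_cong_sets)
    also have "\<dots> = (\<integral>\<^sup>+\<omega>. (\<Sum>z\<in>W. indicator (ev t z) \<omega> * ennreal (step_prob (G t) z y)) \<partial>?C)"
    proof (intro nn_integral_cong)
      fix \<omega> assume "\<omega> \<in> space ?C"
      then have \<omega>: "\<omega> \<in> space (PiM {0..<Suc t} M)" by (simp only: spC)
      have "emeasure (eP (Suc t) \<omega>) (ev (Suc t) y) =
         emeasure (walk_kernel G u (Suc t) \<omega>) ((\<lambda>x. fun_upd \<omega> (Suc t) x) -` ev (Suc t) y)"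
        using \<omega> ev_sets[of "Suc t" y] by (subst emeasure_eP) (auto simp: M_def)
      also have "(\<lambda>x. fun_upd \<omega> (Suc t) x) -` ev (Suc t) y = (if \<forall>i\<le>t. \<omega> i \<in> W then {y} else {})"
        using \<omega> by (auto simp: ev_def space_PiM PiE_iff extensional_def less_Suc_eq_le M_def)
      also have "emeasure (walk_kernel G u (Suc t) \<omega>) \<dots> =
          (if \<forall>i\<le>t. \<omega> i \<in> W then ennreal (step_prob (G t) (\<omega> t) y) else 0)"
        by (auto simp: emeasure_pmf_single)
      \<comment> \<open>The sum over \<open>z\<close> has at most one nonzero term; it makes the
        integrand linear in the indicators of \<open>ev t z\<close>, whose integrals are given by
        the induction hypothesis.\<close>
      also have "\<dots> = (\<Sum>z\<in>W. if z = \<omega> t then (if \<forall>i<t. \<omega> i \<in> W then ennreal (step_prob (G t) z y) else 0) else 0)"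
      proof -
        have "(\<forall>i\<le>t. \<omega> i \<in> W) \<longleftrightarrow> \<omega> t \<in> W \<and> (\<forall>i<t. \<omega> i \<in> W)"
          by (auto simp: le_less)
        then show ?thesis using W by (simp add: sum.delta)
      qed
      also have "\<dots> = (\<Sum>z\<in>W. indicator (ev t z) \<omega> * ennreal (step_prob (G t) z y))"
        using \<omega> by (intro sum.cong) (auto simp: ev_def indicator_def)
      finally show "emeasure (eP (Suc t) \<omega>) (ev (Suc t) y) = \<dots>" .
    qed
    also have "\<dots> = (\<Sum>z\<in>W. emeasure ?C (ev t z) * ennreal (step_prob (G t) z y))"
    proof -
      have "ev t z \<in> sets ?C" for z
        unfolding stC by (rule ev_sets)
      then show ?thesis
        by (simp add: nn_integral_sum nn_integral_multc del: C.simps)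
    qed
    finally show ?case
      by (simp add: Suc del: C.simps)
  qed
  have "{\<omega>. (\<forall>i<t. \<omega> i \<in> W) \<and> \<omega> t = y} = PF.emb UNIV {0..<Suc t} (ev t y)"
    by (auto simp: prod_emb_def ev_def M_def space_PiM)
  then have "emeasure (random_walk G u) {\<omega>. (\<forall>i<t. \<omega> i \<in> W) \<and> \<omega> t = y} = emeasure (CI {0..<Suc t}) (ev t y)"
    using ev_sets[of t y] unfolding random_walk_def by (simp add: lim M_def)
  also have "\<dots> = emeasure (C 0 (Suc t) (\<lambda>_. undefined)) (PF.emb {0..<Suc t} {0..<Suc t} (ev t y))"
    using ev_sets[of t y] by (intro emeasure_CI) (auto simp: M_def)
  also have "PF.emb {0..<Suc t} {0..<Suc t} (ev t y) = ev t y"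
    using sets.sets_into_space[OF ev_sets[of t y]] by (intro prod_emb_id) (simp add: M_def space_PiM)
  finally show ?thesis by (simp add: C del: C.simps)
qed

text \<open>A trajectory that lies in \<open>W\<close> up to time \<open>t\<close> has not met
  \<open>v\<close> by then, so \<open>steps_until v\<close> exceeds \<open>t\<close>. The number of
  such \<open>t\<close> is a lower bound for \<open>steps_until v\<close>, and integrating it gives
  the masses of \<open>emeasure_random_walk\<close>.\<close>

lemma hitting_time_on_ge:
  fixes G :: "'a::countable dynamic_graph"
  assumes W: "finite W" "v \<notin> W"
  shows "hitting_time_on G u v \<ge>
    (\<Sum>t<T. \<Sum>y\<in>W. alive (\<lambda>s z y. ennreal (step_prob (G s) z y)) W u t y)"
proof -
  interpret Ionescu_Tulcea "walk_kernel G u" "\<lambda>_. count_space UNIV"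
    by (rule Ionescu_Tulcea_walk_kernel)
  define ev where "ev t y = {\<omega>. (\<forall>i<t. \<omega> i \<in> W) \<and> \<omega> t = y}" for t :: nat and y
  have sets: "sets (random_walk G u) = sets (PiM UNIV (\<lambda>_. count_space UNIV))"
    by (simp add: random_walk_def)
  have "{\<omega>\<in>space (PiM UNIV (\<lambda>_. count_space UNIV)). (\<forall>i<t. \<omega> i \<in> W) \<and> \<omega> t = y} \<in>
      sets (PiM UNIV (\<lambda>_. count_space (UNIV::'a set)))" for t :: nat and y
    by measurable
  then have [measurable]: "ev t y \<in> sets (random_walk G u)" for t y
    by (simp add: ev_def sets space_PiM)
  have "(\<Sum>t<T. \<Sum>y\<in>W. alive (\<lambda>s z y. ennreal (step_prob (G s) z y)) W u t y) =
      (\<integral>\<^sup>+\<omega>. (\<Sum>t<T. \<Sum>y\<in>W. indicator (ev t y) \<omega>) \<partial>random_walk G u)"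
    by (simp add: nn_integral_sum emeasure_random_walk[OF W(1), symmetric] ev_def[symmetric])
  also have "\<dots> \<le> hitting_time_on G u v"
    unfolding hitting_time_on_def
  proof (intro nn_integral_mono)
    fix \<omega> :: "nat \<Rightarrow> 'a"
    have "(\<Sum>t<T. \<Sum>y\<in>W. indicator (ev t y) \<omega>) \<le>
        (\<Sum>t<T. if enat t < steps_until v \<omega> then 1 else 0 :: ennreal)"
    proof (intro sum_mono)
      fix t
      have "(\<Sum>y\<in>W. indicator (ev t y) \<omega>) = (\<Sum>y\<in>W. if y = \<omega> t then (if \<forall>i<t. \<omega> i \<in> W then 1 else 0) else 0 :: ennreal)"
        by (intro sum.cong) (auto simp: ev_def)
      also have "\<dots> = (if \<forall>i\<le>t. \<omega> i \<in> W then 1 else 0)"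
        using W by (auto simp: sum.delta' le_less)
      also have "\<dots> \<le> (if enat t < steps_until v \<omega> then 1 else 0)"
      proof (cases "\<forall>i\<le>t. \<omega> i \<in> W")
        case True
        have "enat (Suc t) \<le> steps_until v \<omega>"
          unfolding steps_until_def
        proof (intro INF_greatest)
          fix i assume "i \<in> {t. \<omega> t = v}"
          with True W(2) have "\<not> i \<le> t" by auto
          then show "enat (Suc t) \<le> enat i" by simp
        qed
        then have "enat t < steps_until v \<omega>"
          by (rule less_le_trans[rotated]) simp
        then show ?thesis by simp
      qed auto
      finally show "(\<Sum>y\<in>W. indicator (ev t y) \<omega>) \<le> (if enat t < steps_until v \<omega> then 1 else 0 :: ennreal)" .
    qed
    also note ennreal_of_enat_ge_sum_indicator
    finally show "(\<Sum>t<T. \<Sum>y\<in>W. indicator (ev t y) \<omega>) \<le> ennreal_of_enat (steps_until v \<omega>)" .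
  qed
  finally show ?thesis .
qed

section \<open>Independence of the graphs at different times\<close>

lemma (in product_prob_space) nn_integral_PiM_mult:
  assumes "i \<in> I" "J \<subseteq> I" "finite J" "i \<notin> J"
    and g [measurable]: "g \<in> borel_measurable (PiM J M)" and h [measurable]: "h \<in> borel_measurable (M i)"
  shows "(\<integral>\<^sup>+x. g (restrict x J) * h (x i) \<partial>PiM I M) =
    (\<integral>\<^sup>+x. g (restrict x J) \<partial>PiM I M) * (\<integral>\<^sup>+y. h y \<partial>M i)"
proof -
  let ?J = "insert i J"
  have eq1: "(\<integral>\<^sup>+x. f (restrict x K) \<partial>PiM I M) = (\<integral>\<^sup>+x. f x \<partial>PiM K M)"
    if "finite K" "K \<subseteq> I" and [measurable]: "f \<in> borel_measurable (PiM K M)" for f :: "_ \<Rightarrow> ennreal" and K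
    using that measurable_restrict_subset[OF that(2), of M]
    by (subst distr_PiM_restrict_finite[OF that(1,2), symmetric], subst nn_integral_distr) auto
  have [measurable]: "(\<lambda>x. restrict x J) \<in> measurable (PiM ?J M) (PiM J M)"
    by (rule measurable_restrict_subset) auto
  have [measurable]: "(\<lambda>x. x i) \<in> measurable (PiM ?J M) (M i)"
    by (rule measurable_component_singleton) simp
  have [simp]: "restrict (restrict x ?J) J = restrict x J" for x :: "_ \<Rightarrow> 'b"
    by (auto simp: fun_eq_iff)
  \<comment> \<open>Both factors depend on finitely many coordinates, so the full product can be
    replaced by the finite one over \<open>insert i J\<close>; there Fubini separates coordinate
    \<open>i\<close>.\<close>
  have "(\<integral>\<^sup>+x. g (restrict x J) * h (x i) \<partial>PiM I M) = (\<integral>\<^sup>+x. g (restrict x J) * h (x i) \<partial>PiM ?J M)"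
    using assms by (subst eq1[of ?J "\<lambda>x. g (restrict x J) * h (x i)", symmetric]) auto
  also have "\<dots> = (\<integral>\<^sup>+x. (\<integral>\<^sup>+y. g (restrict (fun_upd x i y) J) * h y \<partial>M i) \<partial>PiM J M)"
    using assms by (subst product_nn_integral_insert) auto
  also have "\<dots> = (\<integral>\<^sup>+x. g x * (\<integral>\<^sup>+y. h y \<partial>M i) \<partial>PiM J M)"
  proof (intro nn_integral_cong)
    fix x assume "x \<in> space (PiM J M)"
    then have "restrict (fun_upd x i y) J = x" for y
      using \<open>i \<notin> J\<close> by (auto simp: space_PiM fun_eq_iff PiE_iff extensional_def)
    then show "(\<integral>\<^sup>+y. g (restrict (fun_upd x i y) J) * h y \<partial>M i) = g x * (\<integral>\<^sup>+y. h y \<partial>M i)"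
      by (simp add: nn_integral_cmult)
  qed
  also have "\<dots> = (\<integral>\<^sup>+x. g x \<partial>PiM J M) * (\<integral>\<^sup>+y. h y \<partial>M i)"
    by (simp add: nn_integral_multc)
  finally show ?thesis
    using assms by (simp add: eq1)
qed

text \<open>The value of \<open>alive\<close> at time \<open>t\<close> depends only on the graphs
  with index below \<open>t\<close>, hence is independent of the graph \<open>G t\<close> that
  governs the next transition. The expectation therefore factors one step at a time.\<close>

lemma
  fixes p :: "nat \<Rightarrow> 'g pmf" and K :: "'g \<Rightarrow> 'a \<Rightarrow> 'a \<Rightarrow> ennreal"
  defines "M \<equiv> \<lambda>t. measure_pmf (p t)"
  shows alive_measurable: "J \<supseteq> {..<t} \<Longrightarrow> (\<lambda>G. alive (\<lambda>s. K (G s)) W u t y) \<in> borel_measurable (PiM J M)"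
    and nn_integral_alive: "(\<integral>\<^sup>+G. alive (\<lambda>s. K (G s)) W u t y \<partial>PiM UNIV M) =
      alive (\<lambda>s z y. \<integral>\<^sup>+g. K g z y \<partial>M s) W u t y"
proof -
  interpret product_prob_space M UNIV
    unfolding product_prob_space_def product_prob_space_axioms_def product_sigma_finite_def M_def
    by (auto intro: measure_pmf.prob_space_axioms measure_pmf.sigma_finite_measure_axioms)
  have meas [measurable]: "h \<in> borel_measurable (M s)" for h :: "'g \<Rightarrow> ennreal" and s
    by (simp add: M_def)
  have meas': "(\<lambda>G. h (G s)) \<in> borel_measurable (PiM J M)" if "s \<in> J" for h :: "'g \<Rightarrow> ennreal" and s J
    using measurable_component_singleton[OF that] meas by (rule measurable_compose)
  have am: "(\<lambda>G. alive (\<lambda>s. K (G s)) W u t y) \<in> borel_measurable (PiM J M)"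
    if "J \<supseteq> {..<t}" for t y J
    using that
  proof (induction t arbitrary: y)
    case (Suc t)
    from Suc.prems have "{..<t} \<subseteq> J" "t \<in> J" by auto
    then show ?case
      by (auto intro!: borel_measurable_sum borel_measurable_times_ennreal meas' Suc.IH)
  qed simp
  show "(\<lambda>G. alive (\<lambda>s. K (G s)) W u t y) \<in> borel_measurable (PiM J M)" if "J \<supseteq> {..<t}"
    using that by (rule am)
  \<comment> \<open>The restriction makes the dependence on earlier graphs explicit, in the form
    that \<open>nn_integral_PiM_mult\<close> expects.\<close>
  have res: "alive (\<lambda>s. K (G s)) W u t y = alive (\<lambda>s. K (restrict G {..<t} s)) W u t y" for t y and G :: "nat \<Rightarrow> 'g"
    by (rule alive_cong) simp
  show "(\<integral>\<^sup>+G. alive (\<lambda>s. K (G s)) W u t y \<partial>PiM UNIV M) =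
      alive (\<lambda>s z y. \<integral>\<^sup>+g. K g z y \<partial>M s) W u t y"
  proof (induction t arbitrary: y)
    case 0
    show ?case by (simp add: emeasure_space_1)
  next
    case (Suc t)
    have "(\<integral>\<^sup>+G. alive (\<lambda>s. K (G s)) W u (Suc t) y \<partial>PiM UNIV M) =
        (\<Sum>z\<in>W. \<integral>\<^sup>+G. alive (\<lambda>s. K (G s)) W u t z * K (G t) z y \<partial>PiM UNIV M)"
      by (simp, subst nn_integral_sum) (auto intro!: borel_measurable_times_ennreal am meas')
    also have "\<dots> = (\<Sum>z\<in>W. (\<integral>\<^sup>+G. alive (\<lambda>s. K (G s)) W u t z \<partial>PiM UNIV M) * (\<integral>\<^sup>+g. K g z y \<partial>M t))"
    proof (intro sum.cong refl)
      fix z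
      show "(\<integral>\<^sup>+G. alive (\<lambda>s. K (G s)) W u t z * K (G t) z y \<partial>PiM UNIV M) =
          (\<integral>\<^sup>+G. alive (\<lambda>s. K (G s)) W u t z \<partial>PiM UNIV M) * (\<integral>\<^sup>+g. K g z y \<partial>M t)"
        using nn_integral_PiM_mult[of t "{..<t}" "\<lambda>G. alive (\<lambda>s. K (G s)) W u t z" "\<lambda>g. K g z y"]
        by (subst (1 2) res) (auto simp: am)
    qed
    finally show ?case by (simp add: Suc)
  qed
qed

text \<open>Let \<open>w t\<close> be the integral of \<open>1 - \<psi>\<close> over the surviving
  mass, whose total is \<open>s t\<close>. Mass that moves to \<open>v\<close> has weight
  \<open>1 - \<psi> v \<le> 0\<close>, so discarding it cannot lower \<open>w\<close>; hence
  \<open>w\<close> starts at 1 and falls by at most \<open>\<epsilon> * s t\<close> per step. Since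
  \<open>w \<le> s\<close>, either \<open>s\<close> drops to \<open>1/2\<close>, and by then the sum
  of \<open>s\<close> has reached \<open>1 / (2 * \<epsilon>)\<close>, or \<open>s\<close> stays
  above \<open>1/2\<close> and the sum diverges.\<close>

lemma survival_time_ge:
  fixes k :: "'a \<Rightarrow> 'a \<Rightarrow> real" and \<psi> :: "'a \<Rightarrow> real"
  assumes V: "finite V" "u \<in> V" "v \<in> V" "u \<noteq> v"
    and k: "\<And>z y. k z y \<ge> 0" "\<And>z. z \<in> V \<Longrightarrow> (\<Sum>y\<in>V. k z y) = 1"
    and \<psi>: "\<And>z. \<psi> z \<ge> 0" "\<psi> v \<ge> 1" "\<psi> u = 0"
    and super: "\<And>z. z \<in> V \<Longrightarrow> z \<noteq> v \<Longrightarrow> (\<Sum>y\<in>V. k z y * \<psi> y) \<le> \<psi> z + \<epsilon>"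
    and "\<epsilon> > 0"
  shows "\<exists>T. (\<Sum>t<T. \<Sum>y\<in>V - {v}. alive (\<lambda>_. k) (V - {v}) u t y) \<ge> 1 / (2 * \<epsilon>)"
proof -
  define W where "W = V - {v}"
  define a where "a = alive (\<lambda>_::nat. k) W u"
  define s where "s t = (\<Sum>y\<in>W. a t y)" for t
  define w where "w t = (\<Sum>y\<in>W. a t y * (1 - \<psi> y))" for t
  have W: "finite W" "u \<in> W" "V = insert v W" "v \<notin> W"
    using V by (auto simp: W_def)
  have a_nonneg: "a t y \<ge> 0" for t y
    unfolding a_def using k(1) by (rule alive_nonneg)
  have w_le: "w t \<le> s t" for t
    unfolding w_def s_def using a_nonneg \<psi>(1) by (intro sum_mono) (simp add: mult_left_le)
  have "w 0 = (\<Sum>y\<in>W. if y = u then 1 - \<psi> y else 0)"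
    unfolding w_def a_def by (intro sum.cong) auto
  then have w0: "w 0 = 1"
    using W \<psi>(3) by (simp add: sum.delta)
  have w_Suc: "w (Suc t) \<ge> w t - \<epsilon> * s t" for t
  proof -
    have "w (Suc t) = (\<Sum>y\<in>W. \<Sum>z\<in>W. a t z * (k z y * (1 - \<psi> y)))"
      unfolding w_def a_def by (simp add: sum_distrib_right mult.assoc)
    also have "\<dots> = (\<Sum>z\<in>W. a t z * (\<Sum>y\<in>W. k z y * (1 - \<psi> y)))"
      by (subst sum.swap) (simp add: sum_distrib_left)
    also have "\<dots> \<ge> (\<Sum>z\<in>W. a t z * (1 - \<psi> z - \<epsilon>))"
    proof (intro sum_mono mult_left_mono a_nonneg)
      fix z assume z: "z \<in> W"
      have "1 - \<psi> z - \<epsilon> \<le> (\<Sum>y\<in>V. k z y) - (\<Sum>y\<in>V. k z y * \<psi> y)"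
        using super[of z] k(2)[of z] z by (auto simp: W_def)
      also have "\<dots> = (\<Sum>y\<in>W. k z y * (1 - \<psi> y)) + k z v * (1 - \<psi> v)"
        using W by (simp add: sum_subtractf algebra_simps)
      also have "\<dots> \<le> (\<Sum>y\<in>W. k z y * (1 - \<psi> y))"
        using k(1)[of z v] \<psi>(2) by (simp add: mult_nonneg_nonpos)
      finally show "1 - \<psi> z - \<epsilon> \<le> (\<Sum>y\<in>W. k z y * (1 - \<psi> y))" .
    qed
    also have "(\<Sum>z\<in>W. a t z * (1 - \<psi> z - \<epsilon>)) = w t - \<epsilon> * s t"
      by (simp add: w_def s_def algebra_simps sum.distrib sum_subtractf sum_distrib_left)
    finally show ?thesis .
  qed
  have w_ge: "w t \<ge> 1 - \<epsilon> * (\<Sum>i<t. s i)" for t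
  proof (induction t)
    case (Suc t)
    then show ?case using w_Suc[of t] by (simp add: algebra_simps)
  qed (simp add: w0)
  have "\<exists>T. (\<Sum>t<T. s t) \<ge> 1 / (2 * \<epsilon>)"
  proof (cases "\<exists>t. s t \<le> 1/2")
    case True
    then obtain t where "s t \<le> 1/2" by blast
    with w_ge[of t] w_le[of t] have "1/2 \<le> \<epsilon> * (\<Sum>i<t. s i)" by linarith
    then show ?thesis using \<open>\<epsilon> > 0\<close> by (intro exI[of _ t]) (simp add: field_simps)
  next
    case False
    obtain T :: nat where T: "real T \<ge> 1 / \<epsilon>" using real_arch_simple by blast
    have "1 / (2 * \<epsilon>) \<le> real T * (1/2)" using T by simp
    also have "\<dots> = (\<Sum>t<T. 1/2)" by simp
    also have "\<dots> \<le> (\<Sum>t<T. s t)" using False by (intro sum_mono) (auto simp: not_le less_imp_le)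
    finally show ?thesis ..
  qed
  then show ?thesis by (simp add: s_def a_def W_def)
qed

section \<open>The chain averaged over the smoothing ball\<close>

definition mean_step :: "'a graph set \<Rightarrow> 'a \<Rightarrow> 'a \<Rightarrow> real" where
  "mean_step B z y = (\<Sum>E\<in>B. step_prob E z y) / card B"

lemma mean_step_nonneg: "mean_step B z y \<ge> 0"
  by (simp add: mean_step_def sum_nonneg)

lemma neighbors_subset: "graph_on V E \<Longrightarrow> neighbors E z \<subseteq> V"
  by (auto simp: graph_on_def neighbors_def doubleton_eq_iff)

text \<open>With a second node \<open>z'\<close>, connectivity gives \<open>z\<close> a neighbor, so
  \<open>pmf_of_set\<close> really is the uniform law on a nonempty finite subset of
  \<open>V\<close>.\<close>

lemma sum_mean_step:
  assumes V: "finite V" "z \<in> V" "z' \<in> V" "z \<noteq> z'"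
    and B: "finite B" "B \<noteq> {}" "\<And>E. E \<in> B \<Longrightarrow> graph_on V E \<and> connected_on V E"
  shows "(\<Sum>y\<in>V. mean_step B z y) = 1"
proof -
  have "(\<Sum>y\<in>V. step_prob E z y) = 1" if "E \<in> B" for E
  proof -
    have sub: "neighbors E z \<subseteq> V"
      using B(3)[OF that] by (intro neighbors_subset) simp
    then show ?thesis
      using neighbors_nonempty[of V E z z'] B(3)[OF that] V finite_subset[OF sub]
      by (intro sum_pmf_eq_1) auto
  qed
  then have "(\<Sum>E\<in>B. \<Sum>y\<in>V. step_prob E z y) = card B" by simp
  moreover have "(\<Sum>y\<in>V. mean_step B z y) = (\<Sum>E\<in>B. \<Sum>y\<in>V. step_prob E z y) / card B"
    unfolding mean_step_def by (subst sum.swap) (simp add: sum_divide_distrib)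
  moreover have "card B > 0" using B(1,2) by (simp add: card_gt_0_iff)
  ultimately show ?thesis by simp
qed

text \<open>The integrand \<open>G \<mapsto> hitting_time_on G u v\<close> of \<open>hitting_time\<close> is not known to be measurable; the
  finite sums of \<open>hitting_time_on_ge\<close> are measurable minorants of it, which is enough for a lower
  bound. By independence their expectations are those of the chain with the averaged transition
  probabilities.\<close>

lemma hitting_time_const_ge:
  fixes u v :: "'a::countable" and \<psi> :: "'a \<Rightarrow> real"
  assumes V: "finite V" "u \<in> V" "v \<in> V" "u \<noteq> v"
    and E: "graph_on V E" "connected_on V E"
    and \<psi>: "\<And>z. \<psi> z \<ge> 0" "\<psi> v \<ge> 1" "\<psi> u = 0"
    and super: "\<And>z. z \<in> V \<Longrightarrow> z \<noteq> v \<Longrightarrow>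
       (\<Sum>y\<in>V. mean_step (smoothing_ball V k E) z y * \<psi> y) \<le> \<psi> z + \<epsilon>"
    and "\<epsilon> > 0"
  shows "hitting_time V (\<lambda>_. E) k u v \<ge> ennreal (1 / (2 * \<epsilon>))"
proof -
  define B where "B = smoothing_ball V k E"
  define W where "W = V - {v}"
  have fB: "finite B" and nB: "B \<noteq> {}"
    using finite_smoothing_ball[OF V(1)] self_mem_smoothing_ball[of "\<lambda>_. E" V 0 k] E
    by (auto simp: B_def G_conn_def)
  have cB: "card B > 0" using fB nB by (simp add: card_gt_0_iff)
  have conn: "graph_on V E' \<and> connected_on V E'" if "E' \<in> B" for E'
    using that by (simp add: B_def smoothing_ball_def)
  have "(\<Sum>y\<in>V. mean_step B z y) = 1" if "z \<in> V" for z
  proof (cases "z = u")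
    case True
    show ?thesis by (rule sum_mean_step[OF V(1) that V(3) _ fB nB conn]) (use True V in auto)
  next
    case False
    show ?thesis by (rule sum_mean_step[OF V(1) that V(2) _ fB nB conn]) (use False in auto)
  qed
  then obtain T where T: "(\<Sum>t<T. \<Sum>y\<in>W. alive (\<lambda>_. mean_step B) W u t y) \<ge> 1 / (2 * \<epsilon>)"
    using survival_time_ge[where k = "mean_step B", OF V mean_step_nonneg _ \<psi> _ \<open>\<epsilon> > 0\<close>] super
    unfolding W_def B_def by blast
  have int: "(\<integral>\<^sup>+g. ennreal (step_prob g z y) \<partial>measure_pmf (pmf_of_set B)) = ennreal (mean_step B z y)" for z y
    using nn_integral_pmf_of_set[OF nB fB, of "\<lambda>g. ennreal (step_prob g z y)"] cB
    by (simp add: mean_step_def divide_ennreal sum_nonneg ennreal_of_nat_eq_real_of_nat)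
  have "ennreal (1 / (2 * \<epsilon>)) \<le> ennreal (\<Sum>t<T. \<Sum>y\<in>W. alive (\<lambda>_. mean_step B) W u t y)"
    using T by (rule ennreal_leI)
  also have "\<dots> = (\<Sum>t<T. \<Sum>y\<in>W. alive (\<lambda>_ z y. ennreal (mean_step B z y)) W u t y)"
    by (simp add: sum_ennreal sum_nonneg alive_ennreal alive_nonneg mean_step_nonneg)
  also have "\<dots> = (\<Sum>t<T. \<Sum>y\<in>W. \<integral>\<^sup>+G. alive (\<lambda>s z y. ennreal (step_prob (G s) z y)) W u t y \<partial>smoothed V k (\<lambda>_. E))"
    using nn_integral_alive[where K = "\<lambda>E z y. ennreal (step_prob E z y)" and p = "\<lambda>_. pmf_of_set B"]
    by (simp add: smoothed_def B_def[symmetric] int)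
  also have "\<dots> = (\<integral>\<^sup>+G. (\<Sum>t<T. \<Sum>y\<in>W. alive (\<lambda>s z y. ennreal (step_prob (G s) z y)) W u t y) \<partial>smoothed V k (\<lambda>_. E))"
    using alive_measurable[where K = "\<lambda>E z y. ennreal (step_prob E z y)" and p = "\<lambda>_. pmf_of_set B" and J = UNIV]
    by (simp add: nn_integral_sum smoothed_def B_def[symmetric])
  also have "\<dots> \<le> hitting_time V (\<lambda>_. E) k u v"
    unfolding hitting_time_def using V(1)
    by (intro nn_integral_mono hitting_time_on_ge) (auto simp: W_def)
  finally show ?thesis .
qed

section \<open>Counting edit sets\<close>

definition pairs :: "'a set \<Rightarrow> 'a set set" where
  "pairs V = {e. e \<subseteq> V \<and> card e = 2}"

lemma finite_pairs: "finite V \<Longrightarrow> finite (pairs V)"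
  by (simp add: pairs_def)

lemma card_pairs: "finite V \<Longrightarrow> card (pairs V) = card V choose 2"
  by (simp add: pairs_def n_subsets)

lemma edit_step_iff:
  "(E, E') \<in> edit_step V \<longleftrightarrow> (\<exists>e\<in>pairs V. E' = sym_diff E {e})"
proof -
  have e: "(\<exists>e\<in>pairs V. P e) \<longleftrightarrow> (\<exists>x\<in>V. \<exists>y\<in>V. x \<noteq> y \<and> P {x, y})" for P
    unfolding pairs_def card_2_iff by blast
  show ?thesis
    unfolding e by (auto simp: edit_step_def)
qed

lemma edit_steps_sym_diff:
  assumes "finite S" "S \<subseteq> pairs V"
  shows "(E, sym_diff E S) \<in> edit_step V ^^ card S"
  using assms
proof (induction S)
  case (insert e S)
  then have "(sym_diff E S, sym_diff (sym_diff E S) {e}) \<in> edit_step V"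
    by (auto simp: edit_step_iff)
  moreover have "sym_diff (sym_diff E S) {e} = sym_diff E (insert e S)"
    using insert.hyps by auto
  ultimately show ?case
    using insert by auto
qed simp

lemma sym_diff_edit_steps:
  assumes "(E, E') \<in> edit_step V ^^ m"
  shows "sym_diff E E' \<subseteq> pairs V \<and> finite (sym_diff E E') \<and> card (sym_diff E E') \<le> m"
  using assms
proof (induction m arbitrary: E')
  case (Suc m)
  then obtain E1 e where E1: "(E, E1) \<in> edit_step V ^^ m" and e: "e \<in> pairs V" "E' = sym_diff E1 {e}"
    by (auto simp: edit_step_iff)
  have sub: "sym_diff E E' \<subseteq> insert e (sym_diff E E1)"
    using e by auto
  have "card (insert e (sym_diff E E1)) \<le> Suc m"
    using Suc.IH[OF E1] by (intro card_insert_le_m1) auto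
  then show ?case
    using Suc.IH[OF E1] e sub card_mono[OF _ sub] finite_subset[OF sub] by auto
qed simp

lemma edit_dist_le_iff:
  "edit_dist V E E' \<le> enat k \<longleftrightarrow> (\<exists>S\<subseteq>pairs V. finite S \<and> card S \<le> k \<and> E' = sym_diff E S)"
proof
  assume le: "edit_dist V E E' \<le> enat k"
  have "{m. (E, E') \<in> edit_step V ^^ m} \<noteq> {}"
  proof
    assume "{m. (E, E') \<in> edit_step V ^^ m} = {}"
    then have "edit_dist V E E' = \<infinity>"
      by (simp add: edit_dist_def top_enat_def del: Collect_empty_eq)
    with le show False by simp
  qed
  \<comment> \<open>A nonempty set of \<open>enat\<close> contains its infimum, so the distance is
    attained by an actual sequence of edits.\<close>
  then have "edit_dist V E E' \<in> enat ` {m. (E, E') \<in> edit_step V ^^ m}"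
    unfolding edit_dist_def by (metis all_not_in_conv image_is_empty wellorder_InfI)
  then obtain m where m: "(E, E') \<in> edit_step V ^^ m" "edit_dist V E E' = enat m" by auto
  then have "m \<le> k" using le by simp
  then show "\<exists>S\<subseteq>pairs V. finite S \<and> card S \<le> k \<and> E' = sym_diff E S"
    using sym_diff_edit_steps[OF m(1)] by (intro exI[of _ "sym_diff E E'"]) auto
next
  assume "\<exists>S\<subseteq>pairs V. finite S \<and> card S \<le> k \<and> E' = sym_diff E S"
  then obtain S where S: "S \<subseteq> pairs V" "finite S" "card S \<le> k" "E' = sym_diff E S" by blast
  have "edit_dist V E E' \<le> enat (card S)"
    unfolding edit_dist_def using edit_steps_sym_diff[OF S(2,1), of E] S(4) by (intro INF_lower) simp
  also have "\<dots> \<le> enat k" using S(3) by simp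
  finally show "edit_dist V E E' \<le> enat k" .
qed

text \<open>The ball is parametrised by the set of toggled pairs. Since \<open>sym_diff E\<close> is
  an involution, a uniform graph of the ball corresponds to a uniform member of this family, and
  probabilities become counts of small subsets of \<open>pairs V\<close>.\<close>

definition edits :: "'a set \<Rightarrow> nat \<Rightarrow> 'a graph \<Rightarrow> 'a set set set" where
  "edits V k E = {S. S \<subseteq> pairs V \<and> card S \<le> k \<and> connected_on V (sym_diff E S)}"

lemma smoothing_ball_eq:
  assumes "finite V" "graph_on V E"
  shows "smoothing_ball V k E = sym_diff E ` edits V k E"
proof -
  have fin: "finite S" if "S \<subseteq> pairs V" for S
    using that finite_pairs[OF assms(1)] finite_subset by blast
  have "pairs V \<subseteq> {{x, y} | x y. x \<in> V \<and> y \<in> V}"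
    by (auto simp: pairs_def card_2_iff)
  then have "graph_on V (sym_diff E S)" if "S \<subseteq> pairs V" for S
    using assms(2) that unfolding graph_on_def by blast
  with fin show ?thesis
    unfolding smoothing_ball_def edit_dist_le_iff edits_def by blast
qed

lemma inj_sym_diff: "inj (sym_diff E)"
proof (rule injI)
  fix S S' assume "sym_diff E S = sym_diff E S'"
  then have "sym_diff E (sym_diff E S) = sym_diff E (sym_diff E S')" by simp
  then show "S = S'" by auto
qed

lemma finite_edits: "finite V \<Longrightarrow> finite (edits V k E)"
  by (rule finite_subset[of _ "Pow (pairs V)"]) (auto simp: edits_def finite_pairs)

lemma card_smoothing_ball:
  assumes "finite V" "graph_on V E"
  shows "card (smoothing_ball V k E) = card (edits V k E)"
  by (simp add: smoothing_ball_eq[OF assms] card_image inj_on_subset[OF inj_sym_diff])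

lemma sum_smoothing_ball:
  assumes "finite V" "graph_on V E"
  shows "(\<Sum>G\<in>smoothing_ball V k E. f G) = (\<Sum>S\<in>edits V k E. f (sym_diff E S))"
  by (simp add: smoothing_ball_eq[OF assms] sum.reindex inj_on_subset[OF inj_sym_diff])

section \<open>Binomial estimates\<close>

lemma choose_diff_ge:
  assumes "a \<le> N"
  shows "N choose j \<le> ((N - a) choose j) + a * ((N - 1) choose (j - 1))"
  using assms
\<comment> \<open>In effect a union bound over \<open>a\<close> forbidden elements: by Pascal's
  rule, forbidding one more loses at most \<open>(N - 1) choose (j - 1)\<close> subsets.\<close>
proof (induction a)
  case (Suc a)
  show ?case
  proof (cases j)
    case (Suc i)
    obtain M where M: "N - a = Suc M" using \<open>Suc a \<le> N\<close> by (metis Suc_diff_Suc Suc_le_eq)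
    have "(M choose i) \<le> (N - 1) choose i"
      using M by (intro binomial_right_mono) auto
    moreover have "N - Suc a = M" using M by simp
    ultimately show ?thesis
      using Suc.IH \<open>Suc a \<le> N\<close> M Suc by simp
  qed simp
qed simp

text \<open>A random \<open>j\<close>-subset meets a fixed \<open>a\<close>-set in
  \<open>a * j / N \<le> 1/2\<close> elements on average, so at least half of the
  \<open>j\<close>-subsets avoid it.\<close>

lemma choose_diff_ge_half:
  assumes "a \<le> N" "2 * a * j \<le> N"
  shows "N choose j \<le> 2 * ((N - a) choose j)"
proof (cases j)
  case (Suc i)
  show ?thesis
  proof (cases "N = 0")
    case False
    have *: "j * (N choose j) = N * ((N - 1) choose (j - 1))"
      using False Suc by (metis Suc_pred' binomial_absorption diff_Suc_1 neq0_conv)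
    have "2 * (j * (a * ((N - 1) choose (j - 1)))) = (2 * a * j) * ((N - 1) choose (j - 1))"
      by simp
    also have "\<dots> \<le> N * ((N - 1) choose (j - 1))"
      using assms(2) by (intro mult_right_mono) auto
    also have "\<dots> = j * (N choose j)" by (simp add: *)
    finally have "j * (2 * (a * ((N - 1) choose (j - 1)))) \<le> j * (N choose j)" by simp
    then have "2 * (a * ((N - 1) choose (j - 1))) \<le> N choose j"
      using Suc by (simp only: nat_mult_le_cancel1)
    with choose_diff_ge[OF assms(1), of j] show ?thesis by linarith
  qed (use assms in simp)
qed simp

text \<open>Up to index \<open>k\<close> consecutive binomials grow by a factor of at least 2, so
  the sum is dominated by a geometric series ending in its top term.\<close>

lemma sum_choose_le:
  assumes "3 * k \<le> N + 1"
  shows "(\<Sum>j\<le>k. N choose j) \<le> 2 * (N choose k)"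
  using assms
proof (induction k)
  case (Suc k)
  have "Suc k * (N choose Suc k) = (N - k) * (N choose k)"
    by (metis binomial_absorb_comp binomial_absorption mult.commute)
  moreover have "(2 * Suc k) * (N choose k) \<le> (N - k) * (N choose k)"
    using Suc.prems by (intro mult_right_mono) auto
  ultimately have "Suc k * (2 * (N choose k)) \<le> Suc k * (N choose Suc k)"
    by (simp only: mult.assoc mult.left_commute)
  then have "2 * (N choose k) \<le> N choose Suc k" by (simp only: nat_mult_le_cancel1)
  with Suc show ?case by simp
qed simp

lemma card_subsets_le:
  assumes "finite A"
  shows "card {S. S \<subseteq> A \<and> card S \<le> k} = (\<Sum>j\<le>k. card A choose j)"
proof -
  have "{S. S \<subseteq> A \<and> card S \<le> k} = (\<Union>j\<le>k. {S. S \<subseteq> A \<and> card S = j})" by auto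
  also have "card \<dots> = (\<Sum>j\<le>k. card {S. S \<subseteq> A \<and> card S = j})"
    using assms by (intro card_UN_disjoint) auto
  finally show ?thesis using assms by (simp add: n_subsets)
qed

lemma card_subsets_le_containing:
  assumes "finite A" "e \<in> A" "k \<ge> 1"
  shows "card {S. S \<subseteq> A \<and> card S \<le> k \<and> e \<in> S} = (\<Sum>j\<le>k-1. (card A - 1) choose j)"
proof -
  have "bij_betw (insert e) {S. S \<subseteq> A - {e} \<and> card S \<le> k - 1} {S. S \<subseteq> A \<and> card S \<le> k \<and> e \<in> S}"
  proof (rule bij_betw_byWitness[where f' = "\<lambda>S. S - {e}"])
    show "insert e ` {S. S \<subseteq> A - {e} \<and> card S \<le> k - 1} \<subseteq> {S. S \<subseteq> A \<and> card S \<le> k \<and> e \<in> S}"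
      using assms by (auto simp: card_insert_if finite_subset[OF _ assms(1)] subset_Diff_insert)
    show "(\<lambda>S. S - {e}) ` {S. S \<subseteq> A \<and> card S \<le> k \<and> e \<in> S} \<subseteq> {S. S \<subseteq> A - {e} \<and> card S \<le> k - 1}"
      using assms finite_subset[OF _ assms(1)] by (auto simp: card_Diff_singleton)
  qed auto
  then have "card {S. S \<subseteq> A \<and> card S \<le> k \<and> e \<in> S} = card {S. S \<subseteq> A - {e} \<and> card S \<le> k - 1}"
    by (simp add: bij_betw_same_card)
  also have "\<dots> = (\<Sum>j\<le>k-1. (card A - 1) choose j)"
    using assms by (subst card_subsets_le) auto
  finally show ?thesis .
qed

section \<open>Counting the edit sets that keep the graph connected\<close>

lemma connected_on_mono: "connected_on V T \<Longrightarrow> T \<subseteq> E \<Longrightarrow> connected_on V E"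
proof -
  assume a: "connected_on V T" "T \<subseteq> E"
  then have "{(a, b). {a, b} \<in> T}\<^sup>* \<subseteq> {(a, b). {a, b} \<in> E}\<^sup>*"
    by (intro rtrancl_mono) auto
  with a(1) show ?thesis by (auto simp: connected_on_def)
qed

text \<open>Toggling only pairs outside the connected subgraph \<open>T\<close> leaves
  \<open>T\<close> in place, so connectivity survives.\<close>

lemma card_edits_ge:
  assumes "finite V" "T \<subseteq> E" "connected_on V T"
  shows "card (edits V k E) \<ge> card (pairs V - T) choose k"
proof -
  have "card {S. S \<subseteq> pairs V - T \<and> card S = k} \<le> card (edits V k E)"
    using assms(2) by (intro card_mono finite_edits assms(1))
      (auto simp: edits_def intro!: connected_on_mono[OF assms(3)])
  then show ?thesis by (simp add: n_subsets finite_pairs assms(1))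
qed

text \<open>With \<open>N = n choose 2\<close>, the number of edit sets agrees with
  \<open>N choose k\<close> up to a factor of 2 either way: avoiding the fewer than \<open>n\<close>
  pairs of \<open>T\<close> costs at most one half, and sets with fewer than \<open>k\<close> pairs
  at most double the count. Absorption,
  \<open>k * (N choose k) = N * ((N - 1) choose (k - 1))\<close>, then turns containing a given pair
  into a probability of order \<open>k / n\<^sup>2\<close>. The second bound counts the ways to
  choose the other \<open>k - 1\<close> edits away from \<open>T\<close> and from a small set
  \<open>U\<close>.\<close>

lemma
  fixes n k :: nat
  assumes V: "finite V" "card V = n" and T: "T \<subseteq> E" "connected_on V T" "T \<subseteq> pairs V" "card T < n"
    and k: "1 \<le> k" "16 * k \<le> n"
  shows edits_containing: "e \<in> pairs V \<Longrightarrow>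
      real (card {S \<in> edits V k E. e \<in> S}) \<le> 16 * real k / real n ^ 2 * real (card (edits V k E))"
    and edits_isolated: "U \<subseteq> pairs V \<Longrightarrow> card U \<le> n - 1 \<Longrightarrow>
      real (card (pairs V - T - U) choose (k - 1)) \<ge> real k / (2 * real n ^ 2) * real (card (edits V k E))"
proof -
  define N where "N = card (pairs V)"
  have N: "N = n choose 2" by (simp add: N_def card_pairs V)
  have N2: "2 * N = n * (n - 1)" using even_diff_nat[of 1 n] unfolding N choose_two by (cases n) auto
  have n16: "n \<ge> 16" using k by simp
  have N2': "2 * N + n = n * n"
    using N2 n16 by (simp add: algebra_simps)
  have Nn: "8 * n \<le> N + n"
  proof -
    have "16 * n \<le> n * n" using n16 by (intro mult_right_mono) auto
    then show ?thesis using N2' n16 by linarith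
  qed
  have nk: "16 * (n * k) \<le> n * n"
    using k(2) by (metis mult_le_mono2 mult.left_commute)
  have fin: "finite (pairs V)" by (rule finite_pairs) fact
  have absorb: "k * (N choose k) = N * ((N - 1) choose (k - 1))"
    using binomial_absorption[of "k - 1" N] k by simp
  have tot: "card (edits V k E) \<le> 2 * (N choose k)"
  proof -
    have "card (edits V k E) \<le> card {S. S \<subseteq> pairs V \<and> card S \<le> k}"
      using fin by (intro card_mono) (auto simp: edits_def)
    also have "\<dots> = (\<Sum>j\<le>k. N choose j)" using fin by (simp add: card_subsets_le N_def)
    also have "\<dots> \<le> 2 * (N choose k)" using k Nn n16 by (intro sum_choose_le) linarith
    finally show ?thesis .
  qed
  have low: "N choose k \<le> 2 * card (edits V k E)"
  proof -
    have le: "card T \<le> N" "card (pairs V - T) = N - card T"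
      using T fin by (auto simp: N_def card_mono card_Diff_subset finite_subset)
    have "2 * card T * k \<le> 2 * (n * k)" using T(4) by simp
    also have "\<dots> \<le> N" using nk N2' n16 Nn by linarith
    finally have "N choose k \<le> 2 * ((N - card T) choose k)"
      using le by (intro choose_diff_ge_half)
    also have "\<dots> \<le> 2 * card (edits V k E)"
      using card_edits_ge[OF V(1) T(1,2), of k] le by simp
    finally show ?thesis .
  qed
  {
    assume e: "e \<in> pairs V"
    have "card {S \<in> edits V k E. e \<in> S} \<le> card {S. S \<subseteq> pairs V \<and> card S \<le> k \<and> e \<in> S}"
      using fin by (intro card_mono) (auto simp: edits_def)
    also have "\<dots> = (\<Sum>j\<le>k-1. (N - 1) choose j)"
      using fin e k by (simp add: card_subsets_le_containing N_def)
    also have "\<dots> \<le> 2 * ((N - 1) choose (k - 1))"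
      using k Nn n16 by (intro sum_choose_le) linarith
    finally have "N * card {S \<in> edits V k E. e \<in> S} \<le> N * (2 * ((N - 1) choose (k - 1)))"
      by (rule mult_le_mono2)
    also have "\<dots> = 2 * (k * (N choose k))" using absorb by simp
    also have "\<dots> \<le> 2 * (k * (2 * card (edits V k E)))" using low by simp
    finally have 1: "N * card {S \<in> edits V k E. e \<in> S} \<le> 4 * k * card (edits V k E)" by simp
    have "n * n \<le> 4 * N" using N2' Nn n16 by linarith
    then have "n * n * card {S \<in> edits V k E. e \<in> S} \<le> 4 * N * card {S \<in> edits V k E. e \<in> S}"
      by (rule mult_le_mono1)
    also have "\<dots> \<le> 16 * k * card (edits V k E)" using 1 by simp
    finally have "real (n * n * card {S \<in> edits V k E. e \<in> S}) \<le> real (16 * k * card (edits V k E))"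
      by (rule of_nat_mono)
    then show "real (card {S \<in> edits V k E. e \<in> S}) \<le> 16 * real k / real n ^ 2 * real (card (edits V k E))"
      using n16 by (simp add: field_simps power2_eq_square)
  }
  {
    assume U: "U \<subseteq> pairs V" "card U \<le> n - 1"
    \<comment> \<open>At most \<open>2 * n\<close> pairs lie in \<open>T \<union> U\<close>; the
      further 1 allows a comparison with \<open>N - 1\<close>, the upper index that absorption
      produces.\<close>
    define M where "M = N - 1 - 2 * n"
    have M: "M + 2 * n + 1 = N" using Nn n16 by (simp add: M_def)
    have "card (pairs V - T - U) \<ge> card (pairs V) - card (T \<union> U)"
    proof -
      have "finite (T \<union> U)" using T(3) U(1) fin finite_subset by blast
      moreover have "pairs V - T - U = pairs V - (T \<union> U)" by blast
      ultimately show ?thesis by (simp add: diff_card_le_card_Diff)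
    qed
    moreover have "card (T \<union> U) \<le> 2 * n"
      using card_Un_le[of T U] T U by linarith
    ultimately have "M \<le> card (pairs V - T - U)" using M by (simp add: N_def)
    then have le: "M choose (k - 1) \<le> card (pairs V - T - U) choose (k - 1)"
      by (rule binomial_right_mono)
    have "4 * (n * k) + 2 * n \<le> N + 4 * n" using nk N2' Nn n16 by linarith
    moreover have "2 * (2 * n) * (k - 1) + 4 * n = 4 * (n * k)"
      using k by (simp add: algebra_simps)
    ultimately have "2 * (2 * n) * (k - 1) \<le> N - 1" using n16 by linarith
    then have "(N - 1) choose (k - 1) \<le> 2 * ((N - 1 - 2 * n) choose (k - 1))"
      using M by (intro choose_diff_ge_half) auto
    also have "\<dots> \<le> 2 * (card (pairs V - T - U) choose (k - 1))"
      using le by (simp add: M_def)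
    finally have 2: "N * ((N - 1) choose (k - 1)) \<le> N * (2 * (card (pairs V - T - U) choose (k - 1)))"
      by (rule mult_le_mono2)
    have "k * card (edits V k E) \<le> k * (2 * (N choose k))"
      using tot by (rule mult_le_mono2)
    also have "\<dots> = 2 * (N * ((N - 1) choose (k - 1)))"
      using absorb by simp
    also have "\<dots> \<le> (2 * N) * (2 * (card (pairs V - T - U) choose (k - 1)))" using 2 by simp
    also have "\<dots> \<le> (n * n) * (2 * (card (pairs V - T - U) choose (k - 1)))"
      using N2' by (intro mult_le_mono1) linarith
    finally have "real (k * card (edits V k E)) \<le> real ((n * n) * (2 * (card (pairs V - T - U) choose (k - 1))))"
      by (rule of_nat_mono)
    then show "real (card (pairs V - T - U) choose (k - 1)) \<ge> real k / (2 * real n ^ 2) * real (card (edits V k E))"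
      using n16 by (simp add: field_simps power2_eq_square)
  }
qed

section \<open>The smoothed lollipop\<close>

lemma mean_step_smoothing_ball:
  assumes "finite V" "graph_on V E"
  shows "mean_step (smoothing_ball V k E) z y =
    (\<Sum>S\<in>edits V k E. step_prob (sym_diff E S) z y) / card (edits V k E)"
  by (simp add: mean_step_def sum_smoothing_ball[OF assms] card_smoothing_ball[OF assms])

section \<open>The lollipop and its spanning path\<close>

definition line :: "nat \<Rightarrow> nat graph" where
  "line n = {{x, Suc x} | x. Suc x < n}"

text \<open>A path from \<open>0\<close> to \<open>m\<close> glued at \<open>m\<close> to a clique
  on the nodes from \<open>m\<close> to \<open>n - 1\<close>. Beyond \<open>m\<close> the edges of
  \<open>line n\<close> are clique edges anyway; including all of them exhibits
  \<open>line n\<close> as the connected subgraph \<open>T\<close> of the counting lemmas.\<close>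

definition lollipop :: "nat \<Rightarrow> nat \<Rightarrow> nat graph" where
  "lollipop m n = line n \<union> {{x, y} | x y. m \<le> x \<and> x < y \<and> y < n}"

lemma edge_in_lollipop:
  "{x, y} \<in> lollipop m n \<longleftrightarrow> x < n \<and> y < n \<and> (y = Suc x \<or> x = Suc y \<or> m \<le> x \<and> m \<le> y \<and> x \<noteq> y)"
  using nat_neq_iff[of x y] by (auto simp: lollipop_def line_def doubleton_eq_iff)

lemma line_subset_lollipop: "line n \<subseteq> lollipop m n"
  by (simp add: lollipop_def)

lemma line_subset_pairs: "line n \<subseteq> pairs {..<n}"
  by (auto simp: line_def pairs_def)

lemma card_line: "n > 0 \<Longrightarrow> card (line n) < n"
proof -
  assume "n > 0"
  have "line n = (\<lambda>x. {x, Suc x}) ` {..<n - 1}"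
    by (auto simp: line_def)
  then have "card (line n) \<le> card {..<n - 1}"
    by (simp only: card_image_le finite_lessThan)
  with \<open>n > 0\<close> show ?thesis by simp
qed

lemma connected_line: "connected_on {..<n} (line n)"
proof -
  let ?R = "{(a, b). {a, b} \<in> line n}"
  have "(0, x) \<in> ?R\<^sup>* \<and> (x, 0) \<in> ?R\<^sup>*" if "x < n" for x
    using that
  proof (induction x)
    case (Suc x)
    then have "(x, Suc x) \<in> ?R" "(Suc x, x) \<in> ?R"
      by (auto simp: line_def insert_commute)
    with Suc show ?case
      by (auto intro: rtrancl_into_rtrancl converse_rtrancl_into_rtrancl)
  qed simp
  then show ?thesis
    by (auto simp: connected_on_def intro: rtrancl_trans)
qed

lemma graph_on_lollipop: "graph_on {..<n} (lollipop m n)"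
  unfolding graph_on_def
proof
  fix e assume "e \<in> lollipop m n"
  then obtain x y where "e = {x, y}" "x < n" "y < n"
    unfolding lollipop_def line_def using Suc_lessD less_trans by blast
  then show "e \<in> {{x, y} | x y. x \<in> {..<n} \<and> y \<in> {..<n}}" by blast
qed

lemma connected_lollipop: "connected_on {..<n} (lollipop m n)"
  using connected_line line_subset_lollipop by (rule connected_on_mono)

section \<open>Transition probabilities of the averaged chain\<close>

context
  fixes n m k :: nat and K :: "nat \<Rightarrow> nat \<Rightarrow> real" and \<delta> :: real
  defines "K \<equiv> mean_step (smoothing_ball {..<n} k (lollipop m n))"
    and "\<delta> \<equiv> 16 * real k / real n ^ 2"
  assumes n: "1000 \<le> n" and m: "m = n div 2" and k: "1 \<le> k" "16 * k \<le> n"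
begin

abbreviation (input) "edit_sets \<equiv> edits {..<n} k (lollipop m n)"
abbreviation (input) "nbrs S z \<equiv> neighbors (sym_diff (lollipop m n) S) z"

lemma finite_edit_sets: "finite edit_sets" by (rule finite_edits) simp

lemma edit_sets_pos: "card edit_sets > 0"
proof -
  have "{} \<in> edit_sets" by (simp add: edits_def connected_lollipop)
  then show ?thesis using finite_edit_sets by (auto simp: card_gt_0_iff)
qed

lemma K_eq: "K z y = (\<Sum>S\<in>edit_sets. step_prob (sym_diff (lollipop m n) S) z y) / card edit_sets"
  unfolding K_def by (rule mean_step_smoothing_ball) (simp_all add: graph_on_lollipop)

lemma mem_nbrs: "S \<in> edit_sets \<Longrightarrow> y \<in> nbrs S z \<longleftrightarrow> (({z, y} \<in> lollipop m n) \<noteq> ({z, y} \<in> S))"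
  by (auto simp: neighbors_def)

lemma nbrs_subset: "S \<in> edit_sets \<Longrightarrow> nbrs S z \<subseteq> {..<n}"
  by (auto simp: neighbors_def edge_in_lollipop edits_def pairs_def)

lemma finite_nbrs: "S \<in> edit_sets \<Longrightarrow> finite (nbrs S z)"
  using nbrs_subset finite_subset by blast

lemma nbrs_nonempty:
  assumes "S \<in> edit_sets" "z < n"
  shows "nbrs S z \<noteq> {}"
proof -
  have "connected_on {..<n} (sym_diff (lollipop m n) S)"
    using assms by (simp add: edits_def)
  then show ?thesis
    using neighbors_nonempty[of "{..<n}" _ z "if z = 0 then 1 else 0"] assms n by auto
qed

lemma step_prob_nbrs:
  assumes "S \<in> edit_sets" "z < n"
  shows "step_prob (sym_diff (lollipop m n) S) z y = (if y \<in> nbrs S z then 1 / card (nbrs S z) else 0)"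
  using pmf_of_set[OF nbrs_nonempty[OF assms] finite_nbrs[OF assms(1)]] by (simp add: indicator_def)

lemma edge_toggled: 
  assumes "x < n" "y < n" "x \<noteq> y"
  shows "real (card {S\<in>edit_sets. {x, y} \<in> S}) / card edit_sets \<le> \<delta>"
proof -
  have "real (card {S\<in>edit_sets. {x, y} \<in> S}) \<le> \<delta> * card edit_sets"
    unfolding \<delta>_def using assms n k
    by (intro edits_containing[where T = "line n"] line_subset_lollipop line_subset_pairs connected_line card_line)
       (auto simp: pairs_def)
  then show ?thesis using edit_sets_pos by (simp add: divide_le_eq)
qed

lemma K_loop:
  assumes "z < n"
  shows "K z z = 0"
proof -
  have "step_prob (sym_diff (lollipop m n) S) z z = 0" if S: "S \<in> edit_sets" for S
  proof -
    have "{z} \<notin> S" using S by (auto simp: edits_def pairs_def)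
    moreover have "{z} \<notin> lollipop m n" using edge_in_lollipop[of z z] by simp
    ultimately have "z \<notin> nbrs S z" by (simp add: mem_nbrs[OF S])
    then show ?thesis using S assms by (simp add: step_prob_nbrs)
  qed
  then show ?thesis by (simp add: K_eq)
qed

text \<open>The step needs the pair to be toggled, which has probability at most
  \<open>\<delta>\<close>, and is then taken with probability at most \<open>c\<close>. The diagonal
  is separate because loops are never toggled.\<close>

lemma K_non_edge:
  assumes z: "z < n" and y: "y < n" "{z, y} \<notin> lollipop m n" and "c \<ge> 0"
    and c: "\<And>S. S \<in> edit_sets \<Longrightarrow> step_prob (sym_diff (lollipop m n) S) z y \<le> c"
  shows "K z y \<le> c * \<delta>"
proof (cases "y = z")
  case True
  then show ?thesis using K_loop[OF z] \<open>c \<ge> 0\<close> by (simp add: \<delta>_def)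
next
  case False
  have "(\<Sum>S\<in>edit_sets. step_prob (sym_diff (lollipop m n) S) z y) \<le> (\<Sum>S\<in>edit_sets. if {z, y} \<in> S then c else 0)"
  proof (intro sum_mono)
    fix S assume S: "S \<in> edit_sets"
    show "step_prob (sym_diff (lollipop m n) S) z y \<le> (if {z, y} \<in> S then c else 0)"
    proof (cases "{z, y} \<in> S")
      case True then show ?thesis using c[OF S] by simp
    next
      case False
      then have "y \<notin> nbrs S z" using y by (subst mem_nbrs[OF S]) simp
      then show ?thesis using False S z by (simp add: step_prob_nbrs)
    qed
  qed
  also have "\<dots> = c * card {S\<in>edit_sets. {z, y} \<in> S}"
    using finite_edit_sets by (simp add: sum.If_cases Int_def mult.commute)
  finally have "K z y \<le> c * (card {S\<in>edit_sets. {z, y} \<in> S} / card edit_sets)"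
    by (simp add: K_eq divide_right_mono)
  also have "\<dots> \<le> c * \<delta>"
    using edge_toggled[of z y] z y False \<open>c \<ge> 0\<close> by (intro mult_left_mono) auto
  finally show ?thesis .
qed

lemma K_path_non_edge:
  assumes "z < m" "y < n" "y \<noteq> Suc z" "z \<noteq> Suc y"
  shows "K z y \<le> \<delta>"
  using K_non_edge[of z y 1] assms m n by (auto simp: edge_in_lollipop pmf_le_1)

text \<open>Unless the edge leading away from \<open>0\<close> is toggled, the node ahead is a
  neighbor, and then stepping back is no more likely than stepping ahead because all neighbors have
  equal probability.\<close>

lemma K_path_drift:
  assumes "Suc z < m"
  shows "K (Suc z) z \<le> K (Suc z) (Suc (Suc z)) + \<delta>"
proof -
  let ?p = "\<lambda>S. step_prob (sym_diff (lollipop m n) S) (Suc z)"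
  have zn: "Suc (Suc z) < n" using assms m n by linarith
  have "(\<Sum>S\<in>edit_sets. ?p S z) \<le> (\<Sum>S\<in>edit_sets. ?p S (Suc (Suc z)) + (if {Suc z, Suc (Suc z)} \<in> S then 1 else 0))"
  proof (intro sum_mono)
    fix S assume S: "S \<in> edit_sets"
    show "?p S z \<le> ?p S (Suc (Suc z)) + (if {Suc z, Suc (Suc z)} \<in> S then 1 else 0)"
    proof (cases "{Suc z, Suc (Suc z)} \<in> S")
      case True
      have "?p S z \<le> 1" "?p S (Suc (Suc z)) \<ge> 0" by (rule pmf_le_1 pmf_nonneg)+
      then have "?p S z \<le> ?p S (Suc (Suc z)) + 1" by (rule order_trans[OF _ le_add_same_cancel2[THEN iffD2]])
      with True show ?thesis by (simp only: if_True)
    next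
      case False
      then have "Suc (Suc z) \<in> nbrs S (Suc z)"
        using zn by (subst mem_nbrs[OF S]) (auto simp: edge_in_lollipop)
      then show ?thesis using zn S by (simp add: step_prob_nbrs)
    qed
  qed
  also have "\<dots> = (\<Sum>S\<in>edit_sets. ?p S (Suc (Suc z))) + card {S\<in>edit_sets. {Suc z, Suc (Suc z)} \<in> S}"
    using finite_edit_sets by (simp add: sum.distrib sum.If_cases Int_def)
  finally have "K (Suc z) z \<le> K (Suc z) (Suc (Suc z)) + card {S\<in>edit_sets. {Suc z, Suc (Suc z)} \<in> S} / card edit_sets"
    by (simp add: K_eq divide_right_mono flip: add_divide_distrib)
  then show ?thesis
    using edge_toggled[of "Suc z" "Suc (Suc z)"] zn by simp
qed

text \<open>At most \<open>k \<le> n / 16\<close> of the \<open>n - m - 1\<close> clique edges at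
  \<open>z\<close> are removed, so at least \<open>n / 4\<close> neighbors remain for every edit
  set.\<close>

lemma clique_step_prob_le:
  assumes "m \<le> z" "z < n" "S \<in> edit_sets"
  shows "step_prob (sym_diff (lollipop m n) S) z y \<le> 4 / real n"
proof -
  define D where "D = {y. {z, y} \<in> S}"
  have fS: "finite S" and cS: "card S \<le> k"
    using assms(3) finite_pairs[of "{..<n}"] by (auto simp: edits_def intro: finite_subset)
  have inj: "inj_on (\<lambda>y. {z, y}) D" by (auto simp: inj_on_def doubleton_eq_iff)
  have "(\<lambda>y. {z, y}) ` D \<subseteq> S" by (auto simp: D_def)
  with fS have "card D \<le> card S" "finite D"
    using card_inj_on_le[OF inj] inj_on_finite[OF inj] by blast+
  have "{m..<n} - {z} - D \<subseteq> nbrs S z"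
    using assms by (auto simp: mem_nbrs edge_in_lollipop D_def)
  then have "card ({m..<n} - {z} - D) \<le> card (nbrs S z)"
    using finite_nbrs[OF assms(3)] by (intro card_mono)
  moreover have "card ({m..<n} - {z}) - card D \<le> card ({m..<n} - {z} - D)"
    using \<open>finite D\<close> by (rule diff_card_le_card_Diff)
  moreover have "card ({m..<n} - {z}) = n - m - 1"
    using assms by (simp add: card_Diff_singleton)
  ultimately have "n - m - 1 - k \<le> card (nbrs S z)"
    using \<open>card D \<le> card S\<close> cS by linarith
  then have "n \<le> 4 * card (nbrs S z)"
    using m n k by linarith
  then have "real n \<le> 4 * real (card (nbrs S z))" by linarith
  then have "1 / real (card (nbrs S z)) \<le> 4 / real n"
    using n by (simp add: field_simps)
  then show ?thesis
    using assms by (simp add: step_prob_nbrs)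
qed

lemma K_clique:
  assumes "m \<le> z" "z < n"
  shows "K z y \<le> 4 / real n"
proof -
  have "(\<Sum>S\<in>edit_sets. step_prob (sym_diff (lollipop m n) S) z y) \<le> (\<Sum>S\<in>edit_sets. 4 / real n)"
    using assms by (intro sum_mono clique_step_prob_le)
  then show ?thesis using edit_sets_pos by (simp add: K_eq divide_le_eq mult.commute)
qed

lemma K_clique_non_edge:
  assumes "m \<le> z" "z < n" "y < n" "{z, y} \<notin> lollipop m n"
  shows "K z y \<le> 4 / real n * \<delta>"
  using assms clique_step_prob_le by (intro K_non_edge) auto

text \<open>It suffices to count edit sets made of \<open>{x, y}\<close> and \<open>k - 1\<close>
  pairs that avoid both \<open>line n\<close> and the set \<open>U\<close> of all pairs at
  \<open>x\<close>. Such an edit keeps the spanning path and leaves \<open>x\<close> with exactly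
  three neighbors, so the step to \<open>y\<close> has probability \<open>1 / 3\<close>.\<close>

lemma K_path_to_clique:
  assumes z: "Suc z < m" and y: "m < y" "y < n"
  shows "K (Suc z) y \<ge> real k / (6 * real n ^ 2)"
proof -
  define x where "x = Suc z"
  define U where "U = (\<lambda>y. {x, y}) ` ({..<n} - {x})"
  define R where "R = pairs {..<n} - line n - U"
  define Z where "Z = {S'. S' \<subseteq> R \<and> card S' = k - 1}"
  have xn: "Suc x < n" and xm: "x < m" using assms m n by (auto simp: x_def)
  have fR: "finite R" by (simp add: R_def finite_pairs)
  have fin: "finite S'" if "S' \<in> Z" for S' using that fR by (auto simp: Z_def intro: finite_subset)
  have U: "U \<subseteq> pairs {..<n}" using xn by (auto simp: U_def pairs_def)
  have cU: "card U \<le> n - 1"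
    using card_image_le[of "{..<n} - {x}" "\<lambda>y. {x, y}"] xn by (simp add: U_def card_Diff_singleton)
  have "real k / (2 * real n ^ 2) * card edit_sets \<le> real (card R choose (k - 1))"
    unfolding R_def using n k U cU
    by (intro edits_isolated line_subset_lollipop line_subset_pairs connected_line card_line) auto
  then have cZ: "real k / (2 * real n ^ 2) * card edit_sets \<le> card Z"
    using fR by (simp add: Z_def n_subsets)
  have xy: "{x, y} \<in> U" using y xm by (auto simp: U_def)
  have not: "{x, y} \<notin> S'" if "S' \<in> Z" for S' using that xy by (auto simp: Z_def R_def)
  have inj: "inj_on (insert {x, y}) Z"
    using not by (intro inj_onI) (metis insert_ident)
  have mem: "insert {x, y} S' \<in> edit_sets" if S': "S' \<in> Z" for S'
  proof -
    have "card (insert {x, y} S') = k"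
      using not[OF S'] fin[OF S'] k S' by (simp add: Z_def)
    moreover have "insert {x, y} S' \<subseteq> pairs {..<n}"
      using S' xy U by (auto simp: Z_def R_def)
    moreover have "{x, y} \<notin> line n"
      using y xm by (auto simp: line_def doubleton_eq_iff)
    then have "line n \<subseteq> sym_diff (lollipop m n) (insert {x, y} S')"
      using S' line_subset_lollipop[of n m] by (auto simp: Z_def R_def)
    then have "connected_on {..<n} (sym_diff (lollipop m n) (insert {x, y} S'))"
      by (rule connected_on_mono[OF connected_line])
    ultimately show ?thesis by (simp add: edits_def)
  qed
  have prob: "step_prob (sym_diff (lollipop m n) (insert {x, y} S')) x y = 1 / 3" if S': "S' \<in> Z" for S'
  proof -
    have "w \<in> nbrs (insert {x, y} S') x \<longleftrightarrow> w \<in> {z, Suc x, y}" for w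
    proof -
      have "{x, w} \<notin> S'"
      proof
        assume w: "{x, w} \<in> S'"
        then have p: "{x, w} \<in> pairs {..<n}" and u: "{x, w} \<notin> U"
          using S' unfolding Z_def R_def by blast+
        from p have "w \<in> {..<n} - {x}" by (cases "w = x") (simp_all add: pairs_def)
        then have "{x, w} \<in> U" unfolding U_def by (rule imageI)
        with u show False by contradiction
      qed
      then have "w \<in> nbrs (insert {x, y} S') x \<longleftrightarrow> ({x, w} \<in> lollipop m n) \<noteq> (w = y)"
        by (subst mem_nbrs[OF mem[OF S']]) (auto simp: doubleton_eq_iff)
      also have "\<dots> \<longleftrightarrow> w \<in> {z, Suc x, y}"
        using xm xn y by (auto simp: edge_in_lollipop x_def)
      finally show ?thesis .
    qed
    then have eq: "nbrs (insert {x, y} S') x = {z, Suc x, y}" by blast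
    have "card {z, Suc x, y} = 3"
      using xm y by (simp add: x_def)
    then show ?thesis
      using xn by (simp add: step_prob_nbrs[OF mem[OF S']] eq)
  qed
  have "real k / (6 * real n ^ 2) * card edit_sets \<le> card Z / 3"
    using cZ by simp
  also have "\<dots> = (\<Sum>S'\<in>Z. step_prob (sym_diff (lollipop m n) (insert {x, y} S')) x y)"
    by (simp add: prob)
  also have "\<dots> = (\<Sum>S\<in>insert {x, y} ` Z. step_prob (sym_diff (lollipop m n) S) x y)"
    by (simp only: sum.reindex[OF inj] o_def)
  also have "\<dots> \<le> (\<Sum>S\<in>edit_sets. step_prob (sym_diff (lollipop m n) S) x y)"
    using mem finite_edit_sets by (intro sum_mono2) auto
  finally have "real k / (6 * real n ^ 2) \<le> K x y"
    using edit_sets_pos by (simp add: K_eq le_divide_eq)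
  then show ?thesis by (simp add: x_def)
qed

text \<open>At least \<open>n / 4\<close> clique nodes serve as targets. This is the rate at which
  the walk is killed on the path, and it forces the geometric decay of the potential.\<close>

lemma K_escape:
  assumes "Suc z < m"
  shows "(\<Sum>y=Suc m..<n. K (Suc z) y) \<ge> real k / (24 * real n)"
proof -
  have "real k / (24 * real n) = (real n / 4) * (real k / (6 * real n ^ 2))"
    using n by (simp add: power2_eq_square)
  also have "\<dots> \<le> real (n - Suc m) * (real k / (6 * real n ^ 2))"
    using m n by (intro mult_right_mono) auto
  also have "\<dots> = (\<Sum>y=Suc m..<n. real k / (6 * real n ^ 2))" by simp
  also have "\<dots> \<le> (\<Sum>y=Suc m..<n. K (Suc z) y)"
    using K_path_to_clique[OF assms] by (intro sum_mono) auto
  finally show ?thesis .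
qed

lemma sum_K:
  assumes "z < n"
  shows "(\<Sum>y<n. K z y) = 1"
proof -
  have "lollipop m n \<in> smoothing_ball {..<n} k (lollipop m n)"
    by (simp add: smoothing_ball_def graph_on_lollipop connected_lollipop)
  then show ?thesis
    unfolding K_def using assms n
    by (intro sum_mean_step[where z' = "if z = 0 then 1 else 0"] finite_smoothing_ball)
       (auto simp: smoothing_ball_def)
qed

lemma K_nonneg: "K z y \<ge> 0"
  by (simp add: K_def mean_step_nonneg)


section \<open>The potential and its drift\<close>

context
  fixes a r \<beta> \<gamma> \<epsilon> :: real and \<psi> :: "nat \<Rightarrow> real"
  defines "a \<equiv> sqrt (real k / real n) / 10" and "r \<equiv> 1 - a" and "\<beta> \<equiv> 384 / (real n * a)"
    and "\<gamma> \<equiv> 8 * \<beta> / real n" and "\<epsilon> \<equiv> 40000 * real k / (real n ^ 3 * a)"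
    and "\<psi> \<equiv> \<lambda>x. if x < m then r ^ x + \<beta> else if x = m then \<gamma> else 0"
begin

text \<open>\<open>\<psi>\<close> bounds, up to an additive drift \<open>\<epsilon>\<close>, the probability of reaching \<open>0\<close> before returning to the
  clique. On the path the walk moves by \<open>\<plusminus>1\<close> and is teleported into the clique at rate about
  \<open>a\<^sup>2\<close>, whence the decay \<open>r ^ x\<close>; \<open>\<beta>\<close>, about \<open>1 / (n * a)\<close>, accounts for teleports from the path to the
  part of the path near \<open>0\<close>. The clique node \<open>m\<close> steps onto the path with probability at most \<open>4 / n\<close>,
  which gives \<open>\<gamma>\<close>.\<close>

lemma a_pos: "a > 0" and a_le: "a \<le> 1 / 40" and a_sq: "a ^ 2 = real k / (100 * real n)"
proof -
  have kn: "real k / real n \<le> 1 / 16"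
    using n k by (simp add: divide_le_eq)
  show "a > 0" using n k by (simp add: a_def)
  have "sqrt (real k / real n) \<le> sqrt (1 / 16)" using kn by (rule real_sqrt_le_mono)
  also have "\<dots> = 1 / 4" by (simp add: real_sqrt_divide)
  finally show "a \<le> 1 / 40" by (simp add: a_def)
  show "a ^ 2 = real k / (100 * real n)"
    by (simp add: a_def power_divide)
qed

lemma r_bounds: "0 < r" "r < 1"
  using a_pos a_le by (auto simp: r_def)

lemma beta_pos: "\<beta> > 0"
  using a_pos n by (simp add: \<beta>_def)

lemma delta_nonneg: "\<delta> \<ge> 0"
  by (simp add: \<delta>_def)

lemma sum_power_r: "finite A \<Longrightarrow> (\<Sum>y\<in>A. r ^ y) \<le> 1 / a"
  using sum_le_suminf[of "\<lambda>y. r ^ y" A] r_bounds suminf_geometric[of r]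
  by (simp add: summable_geometric r_def)

text \<open>Bernoulli bounds \<open>M * a\<close> by \<open>(1 + a) ^ M\<close>, and
  \<open>(1 + a) * (1 - a) \<le> 1\<close>, so \<open>r ^ M \<le> 1 / (M * a)\<close> with
  \<open>M = m - 1\<close> of order \<open>n\<close>. At the clique end the decaying term is thus no
  larger than the constant \<open>\<beta>\<close>.\<close>

lemma power_r_le_beta: "r ^ (m - 1) \<le> \<beta>"
proof -
  let ?M = "m - 1"
  have "real ?M * a * r ^ ?M \<le> (1 + a) ^ ?M * r ^ ?M"
    using Bernoulli_inequality[of a ?M] a_pos r_bounds by (intro mult_right_mono) auto
  also have "\<dots> = (1 - a ^ 2) ^ ?M"
    by (simp add: r_def power_mult_distrib[symmetric] power2_eq_square algebra_simps)
  also have "\<dots> \<le> 1"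
    using a_pos a_le by (intro power_le_one) (auto simp: abs_square_le_1[of a, simplified])
  finally have 1: "real ?M * a * r ^ ?M \<le> 1" .
  have "real n \<le> 384 * real ?M" using m n by linarith
  then have "real n * (a * r ^ ?M) \<le> 384 * real ?M * (a * r ^ ?M)"
    using a_pos r_bounds by (intro mult_right_mono) auto
  with 1 have "real n * (a * r ^ ?M) \<le> 384" by (simp add: mult_ac)
  then show ?thesis using a_pos n by (simp add: \<beta>_def field_simps)
qed

lemma psi_le: "\<psi> y \<le> (if y \<le> m then r ^ y + \<beta> else 0)"
proof -
  have "8 / real n \<le> 1" using n by simp
  then have "\<beta> * (8 / real n) \<le> \<beta> * 1" using beta_pos by (intro mult_left_mono) auto
  then have "\<gamma> \<le> \<beta>" by (simp add: \<gamma>_def mult.commute)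
  moreover have "r ^ m \<ge> 0" using r_bounds by simp
  ultimately have "\<gamma> \<le> r ^ m + \<beta>" by linarith
  then show ?thesis by (simp add: \<psi>_def)
qed

lemma psi_nonneg: "\<psi> y \<ge> 0"
  using r_bounds beta_pos n by (simp add: \<psi>_def \<gamma>_def)

text \<open>After division by \<open>r ^ z\<close> the left side is
  \<open>(1 - a) * (p + q) + a * (p - q) + a ^ 2 * q\<close>. With \<open>t = k / n\<close>, killing
  lowers the first term by nearly \<open>t / 24\<close>, which outweighs the bias
  \<open>a * \<delta>\<close> and the second-order term \<open>t / 100\<close>; the factor
  \<open>1 / 10\<close> in \<open>a\<close> ensures this.\<close>

lemma path_drift:
  fixes p q :: real
  assumes "0 \<le> p" "0 \<le> q" "p \<le> q + \<delta>" "p + q \<le> 1 - real k / (24 * real n)"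
  shows "p * r ^ z + q * r ^ Suc (Suc z) \<le> r ^ Suc z"
proof -
  define t where "t = real k / real n"
  have t: "t > 0" "real k / (24 * real n) = t / 24" "a ^ 2 = t / 100"
    using n k by (auto simp: t_def a_sq)
  have "\<delta> = 16 * t / real n" by (simp add: \<delta>_def t_def power2_eq_square)
  also have "\<dots> \<le> 16 * t / 1000"
    using n t(1) by (intro divide_left_mono) auto
  finally have d: "\<delta> \<le> 16 * t / 1000" .
  have "a * \<delta> \<le> (1 / 40) * (16 * t / 1000)"
    using a_le a_pos d delta_nonneg by (intro mult_mono) auto
  moreover have "a * (p - q) \<le> a * \<delta>"
    using a_pos assms(3) by (intro mult_left_mono) auto
  moreover have "(1 - a) * (p + q) \<le> (1 - a) * (1 - t / 24)"
    using a_le assms(4) t(2) by (intro mult_left_mono) auto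
  moreover have "a ^ 2 * q \<le> t / 100 * 1"
  proof -
    have "q \<le> 1" using assms t(1,2) by linarith
    then show ?thesis using assms t by (intro mult_mono) auto
  qed
  moreover have "a * (t / 24) \<le> 1 / 40 * (t / 24)"
    using a_le t(1) by (intro mult_right_mono) auto
  moreover have "p + q * r ^ 2 = (1 - a) * (p + q) + a * (p - q) + a ^ 2 * q"
    by (simp add: r_def power2_eq_square algebra_simps)
  moreover have "(1 - a) * (1 - s) = r - s + a * s" for s
    by (simp add: r_def algebra_simps)
  note this[of "t / 24"]
  ultimately have "p + q * r ^ 2 \<le> r"
    using t(1) by linarith
  then have "(p + q * r ^ 2) * r ^ z \<le> r * r ^ z"
    using r_bounds by (intro mult_right_mono) auto
  then show ?thesis by (simp add: algebra_simps power2_eq_square)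
qed

text \<open>The two path neighbors are covered by \<open>path_drift\<close>. Jumps to other nodes up
  to \<open>m\<close> add at most \<open>\<delta> / a\<close> to the decaying part, while escape
  into the clique lowers the constant part by \<open>\<beta> * \<kappa>\<close>; the two cancel, so
  no \<open>\<epsilon>\<close> is spent on the path.\<close>

lemma psi_path:
  assumes "Suc z < m"
  shows "(\<Sum>y<n. K (Suc z) y * \<psi> y) \<le> \<psi> (Suc z)"
proof -
  define \<kappa> where "\<kappa> = real k / (24 * real n)"
  let ?K = "K (Suc z)"
  have zn: "Suc z < n" and mn: "m < n" using assms m n by linarith+
  have "{..<n} = {..m} \<union> {Suc m..<n}" using mn by auto
  then have split: "(\<Sum>y<n. f y) = (\<Sum>y\<le>m. f y) + (\<Sum>y=Suc m..<n. f y)" for f :: "nat \<Rightarrow> real"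
    using sum.union_disjoint[of "{..m}" "{Suc m..<n}" f] by (simp add: disjoint_iff)
  have stay: "(\<Sum>y\<le>m. ?K y) \<le> 1 - \<kappa>"
    using sum_K[OF zn] K_escape[OF assms] by (simp add: split \<kappa>_def)
  have pq: "?K z + ?K (Suc (Suc z)) \<le> (\<Sum>y\<le>m. ?K y)"
    using sum_mono2[of "{..m}" "{z, Suc (Suc z)}" ?K] assms K_nonneg by simp
  have "(\<Sum>y\<le>m. ?K y * r ^ y) \<le> (\<Sum>y\<le>m. (if y = z then ?K z * r ^ z else 0) +
      (if y = Suc (Suc z) then ?K (Suc (Suc z)) * r ^ Suc (Suc z) else 0) + \<delta> * r ^ y)"
  proof (intro sum_mono)
    fix y assume y: "y \<in> {..m}"
    have "0 \<le> \<delta> * r ^ y" using r_bounds delta_nonneg by simp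
    moreover have "?K y * r ^ y \<le> \<delta> * r ^ y" if "y \<noteq> z" "y \<noteq> Suc (Suc z)"
      using that K_path_non_edge[of "Suc z" y] assms y mn r_bounds by (intro mult_right_mono) auto
    ultimately show "?K y * r ^ y \<le> (if y = z then ?K z * r ^ z else 0) +
      (if y = Suc (Suc z) then ?K (Suc (Suc z)) * r ^ Suc (Suc z) else 0) + \<delta> * r ^ y"
      by auto
  qed
  also have "\<dots> = ?K z * r ^ z + ?K (Suc (Suc z)) * r ^ Suc (Suc z) + \<delta> * (\<Sum>y\<le>m. r ^ y)"
    using assms by (simp add: sum.distrib sum.delta' sum.delta sum_distrib_left del: power_Suc)
  also have "\<dots> \<le> r ^ Suc z + \<delta> * (1 / a)"
    using K_path_drift[OF assms] K_nonneg pq stay delta_nonneg sum_power_r[of "{..m}"]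
    by (intro add_mono path_drift mult_left_mono) (auto simp: \<kappa>_def)
  \<comment> \<open>The constant 384 in \<open>\<beta>\<close> is 16 * 24, from the 16 of
    \<open>\<delta>\<close> and the 24 of the escape rate.\<close>
  also have "\<delta> * (1 / a) = \<beta> * \<kappa>"
    using n k a_pos by (simp add: \<delta>_def \<beta>_def \<kappa>_def power2_eq_square)
  finally have 1: "(\<Sum>y\<le>m. ?K y * r ^ y) \<le> r ^ Suc z + \<beta> * \<kappa>" .
  have "(\<Sum>y<n. ?K y * \<psi> y) = (\<Sum>y\<le>m. ?K y * \<psi> y)"
    by (simp add: split \<psi>_def)
  also have "\<dots> \<le> (\<Sum>y\<le>m. ?K y * (r ^ y + \<beta>))"
  proof (intro sum_mono mult_left_mono K_nonneg)
    show "\<psi> y \<le> r ^ y + \<beta>" if "y \<in> {..m}" for y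
      using psi_le[of y] that by simp
  qed
  also have "\<dots> = (\<Sum>y\<le>m. ?K y * r ^ y) + \<beta> * (\<Sum>y\<le>m. ?K y)"
    by (simp add: algebra_simps sum.distrib sum_distrib_left)
  also have "\<dots> \<le> (r ^ Suc z + \<beta> * \<kappa>) + \<beta> * (1 - \<kappa>)"
    using 1 stay beta_pos by (intro add_mono mult_left_mono) auto
  also have "\<dots> = \<psi> (Suc z)"
    using assms by (simp add: \<psi>_def algebra_simps)
  finally show ?thesis .
qed

lemma psi_clique:
  assumes "m \<le> z" "z < n"
  shows "(\<Sum>y<n. K z y * \<psi> y) \<le> \<psi> z + \<epsilon>"
proof -
  have mn: "m < n" "m \<ge> 1" using m n by linarith+
  \<comment> \<open>The three summands cover the path edge from \<open>m\<close> to
    \<open>m - 1\<close>, steps from other clique nodes to \<open>m\<close>, and jumps to the path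
    along toggled pairs. The first is paid by \<open>\<psi> m = \<gamma>\<close>, since
    \<open>4 / n * (\<beta> + \<beta>) = \<gamma>\<close>; the other two are charged to
    \<open>\<epsilon>\<close>, with constants 12288 and 24640.\<close>
  let ?f = "\<lambda>y. (if y = m - 1 then if z = m then \<gamma> else 0 else 0) + (if y = m then if z = m then 0 else 4 / real n * \<gamma> else 0)
    + (if y < m then 4 / real n * \<delta> * (r ^ y + \<beta>) else 0)"
  have gam: "\<gamma> \<ge> 0" using beta_pos by (simp add: \<gamma>_def)
  have "(\<Sum>y<n. K z y * \<psi> y) \<le> (\<Sum>y<n. ?f y)"
  proof (intro sum_mono)
    fix y assume y: "y \<in> {..<n}"
    consider "y > m" | "y = m" "z = m" | "y = m" "z \<noteq> m" | "y < m" "z = m" "y = m - 1"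
      | "y < m" "z \<noteq> m \<or> y \<noteq> m - 1"
      using mn by linarith
    then show "K z y * \<psi> y \<le> ?f y"
    proof cases
      case 1 then show ?thesis by (simp add: \<psi>_def)
    next
      case 2
      with K_loop[OF assms(2)] mn show ?thesis by simp
    next
      case 3
      have "K z m * \<gamma> \<le> 4 / real n * \<gamma>"
        using K_clique[OF assms] gam by (intro mult_right_mono)
      with 3 mn show ?thesis by (auto simp: \<psi>_def)
    next
      case 4
      have "K z y * (r ^ (m - 1) + \<beta>) \<le> 4 / real n * (\<beta> + \<beta>)"
        using K_clique[OF assms] power_r_le_beta r_bounds beta_pos
        by (intro mult_mono add_mono) auto
      also have "\<dots> = \<gamma>" by (simp add: \<gamma>_def)
      finally have "K z y * \<psi> y \<le> \<gamma>" using 4 by (simp add: \<psi>_def)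
      moreover have "0 \<le> 4 / real n * \<delta> * (r ^ y + \<beta>)"
        using delta_nonneg r_bounds beta_pos by simp
      moreover have "?f y = \<gamma> + 4 / real n * \<delta> * (r ^ y + \<beta>)"
        using 4 mn by simp
      ultimately show ?thesis by linarith
    next
      case 5
      then have "{z, y} \<notin> lollipop m n" using assms by (auto simp: edge_in_lollipop)
      then have "K z y * (r ^ y + \<beta>) \<le> 4 / real n * \<delta> * (r ^ y + \<beta>)"
        using K_clique_non_edge[OF assms] y r_bounds beta_pos by (intro mult_right_mono) auto
      with 5 show ?thesis by (auto simp: \<psi>_def)
    qed
  qed
  also have "\<dots> = (if z = m then \<gamma> else 0) + (if z = m then 0 else 4 / real n * \<gamma>)
      + (\<Sum>y<n. if y < m then 4 / real n * \<delta> * (r ^ y + \<beta>) else 0)"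
    using mn by (simp add: sum.distrib sum.delta less_imp_diff_less)
  moreover have "(\<Sum>y<n. if y < m then 4 / real n * \<delta> * (r ^ y + \<beta>) else 0) =
      (\<Sum>y<m. 4 / real n * \<delta> * (r ^ y + \<beta>))"
    using mn by (intro sum.mono_neutral_cong_right) auto
  ultimately have 1: "(\<Sum>y<n. K z y * \<psi> y) \<le> (if z = m then \<gamma> else 0) + (if z = m then 0 else 4 / real n * \<gamma>)
      + (\<Sum>y<m. 4 / real n * \<delta> * (r ^ y + \<beta>))"
    by (simp only:)
  have "(\<Sum>y<m. 4 / real n * \<delta> * (r ^ y + \<beta>)) = 4 / real n * \<delta> * ((\<Sum>y<m. r ^ y) + real m * \<beta>)"
    by (simp only: sum_distrib_left[symmetric] sum.distrib) simp
  also have "\<dots> \<le> 4 / real n * \<delta> * (1 / a + real n * \<beta>)"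
    using sum_power_r[of "{..<m}"] delta_nonneg beta_pos mn
    by (intro mult_left_mono add_mono mult_right_mono) auto
  finally have "(\<Sum>y<m. 4 / real n * \<delta> * (r ^ y + \<beta>)) \<le> 4 / real n * \<delta> * (1 / a + real n * \<beta>)" .
  moreover have "real n * \<beta> = 384 * (1 / a)"
    using n by (simp add: \<beta>_def)
  ultimately have 2: "(\<Sum>y<m. 4 / real n * \<delta> * (r ^ y + \<beta>)) \<le> 24640 * real k / (real n ^ 3 * a)"
    by (simp add: \<delta>_def power2_eq_square power3_eq_cube)
  have "4 / real n * \<gamma> = 12288 / (real n ^ 3 * a)"
    by (simp add: \<gamma>_def \<beta>_def power3_eq_cube)
  also have "\<dots> \<le> 12288 * real k / (real n ^ 3 * a)"
    using a_pos k n by (intro divide_right_mono) auto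
  finally have 3: "4 / real n * \<gamma> \<le> 12288 * real k / (real n ^ 3 * a)" .
  have "12288 * real k / (real n ^ 3 * a) + 24640 * real k / (real n ^ 3 * a) = 36928 * real k / (real n ^ 3 * a)"
    by (simp flip: add_divide_distrib)
  also have "\<dots> \<le> \<epsilon>"
    unfolding \<epsilon>_def using a_pos by (intro divide_right_mono) auto
  finally have 4: "12288 * real k / (real n ^ 3 * a) + 24640 * real k / (real n ^ 3 * a) \<le> \<epsilon>" .
  have "(if z = m then \<gamma> else 0) + (if z = m then 0 else 4 / real n * \<gamma>) \<le> \<psi> z + 12288 * real k / (real n ^ 3 * a)"
  proof (cases "z = m")
    case True
    then show ?thesis using a_pos by (simp add: \<psi>_def)
  next
    case False
    then show ?thesis using 3 psi_nonneg[of z] by simp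
  qed
  with 1 2 4 show ?thesis by linarith
qed

lemma epsilon_eq: "1 / (2 * \<epsilon>) = 1 / 800000 * (real n powr (5/2) / sqrt (real k))"
proof -
  have "real n powr (5/2) = real n powr (2 + 1/2)" by simp
  also have "\<dots> = real n ^ 2 * sqrt (real n)"
    using n by (simp only: powr_add) (simp add: powr_half_sqrt)
  finally have "real n powr (5/2) / sqrt (real k) = real n ^ 3 * sqrt (real k / real n) / real k"
    using n k by (simp add: real_sqrt_divide field_simps power2_eq_square power3_eq_cube)
  then show ?thesis
    by (simp add: \<epsilon>_def a_def)
qed

lemma hitting_time_lollipop:
  "hitting_time {..<n} (\<lambda>_. lollipop m n) k (n - 1) 0 \<ge>
    ennreal (1 / 800000 * (real n powr (5/2) / sqrt (real k)))"
  unfolding epsilon_eq[symmetric]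
proof (rule hitting_time_const_ge[where \<psi> = \<psi>])
  fix z assume z: "z \<in> {..<n}" "z \<noteq> 0"
  have eps: "\<epsilon> > 0" using a_pos n k by (simp add: \<epsilon>_def)
  then obtain z' where "z = Suc z'" using z(2) by (cases z) auto
  show "(\<Sum>y\<in>{..<n}. mean_step (smoothing_ball {..<n} k (lollipop m n)) z y * \<psi> y) \<le> \<psi> z + \<epsilon>"
  proof (cases "z < m")
    case True
    with psi_path[of z'] eps \<open>z = Suc z'\<close> show ?thesis by (simp add: K_def)
  next
    case False
    with psi_clique[of z] z show ?thesis by (simp add: K_def)
  qed
next
  show "\<epsilon> > 0" using a_pos n k by (simp add: \<epsilon>_def)
  show "\<psi> 0 \<ge> 1" using m n beta_pos by (simp add: \<psi>_def)
  \<comment> \<open>The start must differ from the attachment node \<open>m\<close>, where the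
    potential is \<open>\<gamma>\<close> rather than 0.\<close>
  have "m < n - 1" using m n by linarith
  then show "\<psi> (n - 1) = 0" by (simp add: \<psi>_def)
  show "n - 1 \<in> {..<n}" "0 \<in> {..<n}" "n - 1 \<noteq> 0" using n by auto
qed (auto intro: graph_on_lollipop connected_lollipop psi_nonneg)

end

end

theorem theorem6p3:
  shows "\<exists>c::real. c > 0 \<and> (\<exists>n0::nat. \<forall>n\<ge>n0.
    \<exists>H \<in> G_conn {..<n}. \<exists>u\<in>{..<n}. \<exists>v\<in>{..<n}.
      \<forall>k::nat. 1 \<le> k \<and> real k \<le> real n / 16 \<longrightarrow>
        hitting_time {..<n} H k u v
          \<ge> ennreal (c * (real n powr (5/2) / (sqrt (real k) * ln (real n)))))"
proof (intro exI[of _ "1 / 800000"] conjI exI[of _ 1000] allI impI)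
  fix n :: nat assume n: "1000 \<le> n"
  have "exp 1 \<le> real n" using exp_le n by linarith
  then have ln: "ln (real n) \<ge> 1" using n by (simp add: ln_ge_iff)
  show "\<exists>H \<in> G_conn {..<n}. \<exists>u\<in>{..<n}. \<exists>v\<in>{..<n}. \<forall>k::nat. 1 \<le> k \<and> real k \<le> real n / 16 \<longrightarrow>
      hitting_time {..<n} H k u v \<ge> ennreal (1 / 800000 * (real n powr (5/2) / (sqrt (real k) * ln (real n))))"
  \<comment> \<open>The lollipop and its two nodes do not depend on \<open>k\<close>, so one choice
    serves all \<open>k\<close>.\<close>
  proof (rule bexI[of _ "\<lambda>_. lollipop (n div 2) n"], rule bexI[of _ "n - 1"], rule bexI[of _ 0], intro allI impI)
    fix k :: nat assume k: "1 \<le> k \<and> real k \<le> real n / 16"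
    \<comment> \<open>Since the logarithm is at least 1, dividing by it only weakens the bound
      already obtained.\<close>
    have "sqrt (real k) \<le> sqrt (real k) * ln (real n)" using ln k by simp
    then have "1 / 800000 * (real n powr (5/2) / (sqrt (real k) * ln (real n))) \<le>
        1 / 800000 * (real n powr (5/2) / sqrt (real k))"
      using k ln by (intro mult_left_mono divide_left_mono) auto
    then have "ennreal (1 / 800000 * (real n powr (5/2) / (sqrt (real k) * ln (real n)))) \<le>
        ennreal (1 / 800000 * (real n powr (5/2) / sqrt (real k)))"
      by (rule ennreal_leI)
    also have "\<dots> \<le> hitting_time {..<n} (\<lambda>_. lollipop (n div 2) n) k (n - 1) 0"
      using n k by (intro hitting_time_lollipop) auto
    finally show "ennreal (1 / 800000 * (real n powr (5/2) / (sqrt (real k) * ln (real n)))) \<le>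
        hitting_time {..<n} (\<lambda>_. lollipop (n div 2) n) k (n - 1) 0" .
  next
    show "(\<lambda>_. lollipop (n div 2) n) \<in> G_conn {..<n}"
      by (simp add: G_conn_def graph_on_lollipop connected_lollipop)
  qed (use n in auto)
qed simp

end
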